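(* Let $\mathcal H$ be a class of measurable functions $h:\mathcal X\to\{-1,+1\}$ satisfying, for some $V>0$, $$\sup_{Q\in\mathcal P(\mathcal X)}N_{d_{Q,2}}(\mathcal H,u)=\mathcal O(u^{-V}),$$ and let $\mathcal F=\mathrm{sconv}(\mathcal H)$. Then for all $t\ge C\log^2n$, with probability at least $1-e^{-t}$ the following bound holds for all $f\in\mathcal F$: $$\mathbb P\{yf(x)\le0\}\le K\inf_{\delta\in(0,1]}\left[\mathbb P_n\{yf(x)\le\delta\}+\hat\varepsilon_n(f,\delta)+\frac{t}{n\delta^2}\right],$$ where $K,C>0$ are absolute constants.
   Context: $\mathcal X$ is a measurable space, $\mathcal Y=\{-1,+1\}$, $\mathbb P$ is a probability measure on $\mathcal X\times\mathcal Y$, and $(X_1,Y_1),\dots,(X_n,Y_n)$ are i.i.d. with law $\mathbb P$; "with probability" refers to this sample. $\mathbb P_n$ is the empirical distribution of the sample; for functions of $x$ only, $\mathbb P_ng=n^{-1}\sum_{i=1}^ng(X_i)$. $\mathcal P(\mathcal X)$ is the set of all discrete probability distributions on $\mathcal X$; $d_{Q,2}(f,g)=(Q(f-g)^2)^{1/2}$ for a probability measure $Q$; $N_{d_{Q,2}}(\mathcal G,u)$ is the minimal number of $d_{Q,2}$-balls of radius $u>0$ with centers in $\mathcal G$ needed to cover $\mathcal G$. Symmetric convex hull: $\mathrm{sconv}(\mathcal G)=\{\sum_{i=1}^N\lambda_ih_i:h_i\in\mathcal G,\lambda_i\in\mathbb R,\sum_{i=1}^N|\lambda_i|\le1,N\ge1\}$.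 For $f\in\mathcal F$, $N_{d_{Q,2}}(f,\varepsilon)=\inf\{N_{d_{Q,2}}(\mathcal H',\varepsilon):\mathcal H'\subset\mathcal H,\ f\in\mathrm{sconv}(\mathcal H')\}$, and $$\hat\psi_n(f;\delta)=\int_0^\delta\sqrt{N_{d_{\mathbb P_n,2}}(f,\varepsilon)\log(1/\varepsilon)}\,d\varepsilon.$$ For a concave nondecreasing function $\psi$ on $[0,+\infty)$ with $\psi(0)=0$, $\varepsilon_n^\psi(\delta)$ is the largest solution $\varepsilon$ of the equation $\varepsilon=\frac1{\delta\sqrt n}\psi(\delta\sqrt\varepsilon)$. Finally $\hat\varepsilon_n(f,\delta)=\varepsilon_n^{\psi}(\delta)$ with $\psi(\cdot)=\hat\psi_n(f;\cdot)$.
   Formalization: The class H is additionally assumed pointwise measurable (each h is a pointwise limit of functions from one countable subclass), and C may depend on V and on the constants hidden in O(u^{-V}), while K is absolute; without these changes the claim is false. *)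

theory Defs
  imports "HOL-Probability.Probability"
begin

definition L2_dist :: "'a measure \<Rightarrow> ('a \<Rightarrow> real) \<Rightarrow> ('a \<Rightarrow> real) \<Rightarrow> real" where
  "L2_dist Q f g = sqrt (\<integral>x. (f x - g x)\<^sup>2 \<partial>Q)"

text \<open>Balls are closed. The value is \<open>\<infinity>\<close> if there is no finite cover, since the infimum
  of the empty set in \<^typ>\<open>enat\<close> is the top element.\<close>

definition covering_number :: "('b \<Rightarrow> 'b \<Rightarrow> real) \<Rightarrow> 'b set \<Rightarrow> real \<Rightarrow> enat" where
  "covering_number d G u =
     (INF S \<in> {S. finite S \<and> S \<subseteq> G \<and> G \<subseteq> (\<Union>c\<in>S. {g. d c g \<le> u})}. enat (card S))"

definition discrete_distributions :: "'a measure \<Rightarrow> 'a pmf set" where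
  "discrete_distributions M = {Q. set_pmf Q \<subseteq> space M}"

text \<open>For a fixed exponent \<open>V\<close>, the existence of \<open>A > 0\<close> and \<open>u0 > 0\<close> with this property says that
  the supremum of the covering numbers over all discrete distributions is \<open>O(u powr (-V))\<close>
  as \<open>u\<close> tends to \<open>0\<close>. The two witnesses are parameters so that one can
  express that a constant depends on the class only through them.\<close>

definition uniform_covering_bound ::
  "'a measure \<Rightarrow> ('a \<Rightarrow> real) set \<Rightarrow> real \<Rightarrow> real \<Rightarrow> real \<Rightarrow> bool" where
  "uniform_covering_bound M H V A u0 \<longleftrightarrow>
     (\<forall>u\<in>{0<..u0}.
        ereal_of_enat (SUP Q\<in>discrete_distributions M.
           covering_number (L2_dist (measure_pmf Q)) H u) \<le> ereal (A * u powr (-V)))"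

text \<open>The usual separability condition that rules out measurability pathologies of
  uncountable classes. It cannot be dropped: on the first uncountable ordinal with the
  countable/co-countable sigma-algebra, the indicators of initial segments (with values
  \<open>-1, 1\<close>) have VC dimension one, but do not satisfy a uniform law of large numbers.\<close>

definition pointwise_measurable :: "'a measure \<Rightarrow> ('a \<Rightarrow> real) set \<Rightarrow> bool" where
  "pointwise_measurable M H \<longleftrightarrow>
     (\<exists>H0\<subseteq>H. countable H0 \<and>
        (\<forall>h\<in>H. \<exists>g. (\<forall>k::nat. g k \<in> H0) \<and> (\<forall>x\<in>space M. (\<lambda>k. g k x) \<longlonglongrightarrow> h x)))"

definition sconv :: "('a \<Rightarrow> real) set \<Rightarrow> ('a \<Rightarrow> real) set" where
  "sconv G = {f. \<exists>(N::nat) (l::nat \<Rightarrow> real) h. N \<ge> 1 \<and> (\<forall>i\<in>{1..N}. h i \<in> G) \<and>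
     (\<Sum>i=1..N. \<bar>l i\<bar>) \<le> 1 \<and> f = (\<lambda>x. \<Sum>i=1..N. l i * h i x)}"

definition function_covering_number ::
  "'a measure \<Rightarrow> ('a \<Rightarrow> real) set \<Rightarrow> ('a \<Rightarrow> real) \<Rightarrow> real \<Rightarrow> enat" where
  "function_covering_number Q H f \<epsilon> =
     (INF H' \<in> {H'. H' \<subseteq> H \<and> f \<in> sconv H'}. covering_number (L2_dist Q) H' \<epsilon>)"

text \<open>For \<open>f \<in> sconv H\<close> the covering number below is finite and bounded in \<open>\<epsilon>\<close>, because \<open>f\<close> is
  a combination of finitely many elements of \<open>H\<close>. The logarithm is replaced by its positive
  part, so that the integral is constant in \<open>\<delta>\<close> beyond \<open>1\<close> and hence concave and
  nondecreasing on \<open>[0, \<infinity>)\<close>; for \<open>\<delta> \<le> 1\<close> this changes nothing.\<close>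

definition psi_hat ::
  "'a measure \<Rightarrow> ('a \<Rightarrow> real) set \<Rightarrow> ('a \<Rightarrow> real) \<Rightarrow> real \<Rightarrow> real" where
  "psi_hat Q H f \<delta> =
     (LBINT \<epsilon>:{0<..\<delta>}.
        sqrt (real (the_enat (function_covering_number Q H f \<epsilon>)) * max 0 (ln (1 / \<epsilon>))))"

definition eps_sol :: "nat \<Rightarrow> (real \<Rightarrow> real) \<Rightarrow> real \<Rightarrow> real" where
  "eps_sol n \<psi> \<delta> =
     (GREATEST \<epsilon>. 0 \<le> \<epsilon> \<and> \<epsilon> = 1 / (\<delta> * sqrt (real n)) * \<psi> (\<delta> * sqrt \<epsilon>))"

definition empirical :: "nat \<Rightarrow> (nat \<Rightarrow> 'b) \<Rightarrow> 'b pmf" where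
  "empirical n z = map_pmf z (pmf_of_set {1..n})"

definition eps_hat ::
  "nat \<Rightarrow> (nat \<Rightarrow> 'a \<times> real) \<Rightarrow> ('a \<Rightarrow> real) set \<Rightarrow> ('a \<Rightarrow> real) \<Rightarrow> real \<Rightarrow> real" where
  "eps_hat n z H f \<delta> =
     eps_sol n (psi_hat (measure_pmf (map_pmf fst (empirical n z))) H f) \<delta>"

definition labels :: "real measure" where
  "labels = count_space {-1, 1}"

end

theory Submission
  imports Defs
begin

text \<open>
  For \<open>n \<ge> 2\<close> the bound follows from a margin argument in which the entropy of the
  class is paid for by the confidence term. Since \<open>H\<close> has polynomial uniform covering
  numbers and consists of functions with values \<open>-1, 1\<close>, it induces only polynomially many
  sign patterns on \<open>2n\<close> points: a cover at scale \<open>1/\<surd>n\<close> in the empirical \<open>L\<^sub>2\<close> distance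
  already separates all patterns (\<open>finite_patterns_card_le\<close>). A convex combination \<open>f\<close> is
  replaced by the vote of \<open>m\<close> functions from \<open>H \<union> -H \<union> {0}\<close>, where \<open>m\<close> is of
  order \<open>ln n / \<delta>\<^sup>2\<close>. Drawing the voters independently according to the weights of \<open>f\<close> shows
  that some vote has normalized margin at most \<open>\<delta>/2\<close> at almost all points where \<open>f\<close> has margin
  at most \<open>0\<close>, and normalized margin more than \<open>\<delta>/2\<close> at almost all sample points where \<open>f\<close> has
  margin more than \<open>\<delta>\<close>, with an exceptional mass of order \<open>1/n\<close> (\<open>exists_vote_close_to_sconv\<close>).

  The votes of length \<open>m\<close> have at most \<open>(m + 1) (3 G) ^ m\<close> patterns on \<open>2n\<close> points, where \<open>G\<close>
  bounds the number of sign patterns of \<open>H\<close>, so the logarithm of their number is of order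
  \<open>(ln n)\<^sup>2 / \<delta>\<^sup>2\<close>, with a factor that depends on \<open>V\<close>, \<open>A\<close> and \<open>u0\<close>. A relative deviation
  inequality for classes of sets (\<open>relative_deviation_uniform\<close>) bounds the probability of each
  such set by three times its empirical frequency plus a multiple of (entropy \<open>+ t\<close>)\<open>/n\<close>. The
  condition \<open>t \<ge> C (ln n)\<^sup>2\<close>, with \<open>C\<close> equal to that factor, turns the last term into an
  absolute constant times \<open>t / (n \<delta>\<^sup>2)\<close> (\<open>vote_complexity_le\<close>). This is why \<open>K\<close> is absolute
  while \<open>C\<close> depends on the covering bound.

  For \<open>n = 1\<close> the logarithm vanishes and \<open>t\<close> may be arbitrarily small. Here the local
  complexity term takes over: the equation that defines it always has a largest solution, which
  is at least \<open>1/(4n)\<close> because covering numbers are at least \<open>1\<close> (\<open>eps_hat_ge\<close>), so ten times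
  the right side exceeds \<open>1\<close>. The same lemma provides its nonnegativity for \<open>n \<ge> 2\<close>.
\<close>

section \<open>Symmetrization with multiplicative weights\<close>

definition hits :: "nat set \<Rightarrow> (nat \<Rightarrow> 'z) \<Rightarrow> 'z set \<Rightarrow> nat set" where
  "hits J w A = {j \<in> J. w j \<in> A}"

text \<open>Indices \<open>1..n\<close> belong to the sample and \<open>n+1..2n\<close> to an independent ghost sample.
  A hit in the sample is discounted by \<open>1/2\<close> and a hit in the ghost sample is rewarded by \<open>3/2\<close>;
  these weights average to at most \<open>1\<close> when the two points of a pair are exchanged at random.\<close>

definition pair_weight :: "nat \<Rightarrow> nat set \<Rightarrow> real" where
  "pair_weight n p =
     (\<Prod>i\<in>{1..n}. (if i \<in> p then 1/2 else 1) * (if n + i \<in> p then 3/2 else 1))"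

definition swap_pairs :: "nat \<Rightarrow> nat set \<Rightarrow> nat \<Rightarrow> nat" where
  "swap_pairs n \<sigma> j =
     (if j \<in> \<sigma> then n + j else if n < j \<and> j - n \<in> \<sigma> then j - n else j)"

lemma swap_pairs_in:
  assumes "\<sigma> \<subseteq> {1..n}" "j \<in> {1..2*n}"
  shows "swap_pairs n \<sigma> j \<in> {1..2*n}"
  using assms by (force simp: swap_pairs_def)

lemma swap_pairs_invol:
  assumes "\<sigma> \<subseteq> {1..n}"
  shows "swap_pairs n \<sigma> (swap_pairs n \<sigma> j) = j"
  using assms by (force simp: swap_pairs_def)

lemma swap_pairs_inj: "\<sigma> \<subseteq> {1..n} \<Longrightarrow> inj_on (swap_pairs n \<sigma>) S"
  by (metis inj_onI swap_pairs_invol)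

text \<open>The sum over all exchanges factorizes over the pairs. The factor of a pair is
  \<open>1 + 1\<close>, \<open>1/2 + 3/2\<close> or \<open>3/4 + 3/4\<close>, according to whether none, one or both of its points
  are hit, hence at most \<open>2\<close>.\<close>

lemma sum_swapped_pair_weight_le:
  "(\<Sum>\<sigma>\<in>Pow {1..n}. pair_weight n {j \<in> {1..2*n}. swap_pairs n \<sigma> j \<in> p}) \<le> 2 ^ n"
proof -
  define v where "v i = (if i \<in> p then 1/2 else 1 :: real)" for i
  define u where "u i = (if i \<in> p then 3/2 else 1 :: real)" for i
  have *: "pair_weight n {j \<in> {1..2*n}. swap_pairs n \<sigma> j \<in> p} =
     (\<Prod>i\<in>\<sigma>. v (n+i) * u i) * (\<Prod>i\<in>{1..n}-\<sigma>. v i * u (n+i))" if s: "\<sigma> \<subseteq> {1..n}" for \<sigma>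
  proof -
    have fin: "finite \<sigma>" using s by (rule finite_subset) auto
    have "pair_weight n {j \<in> {1..2*n}. swap_pairs n \<sigma> j \<in> p} =
      (\<Prod>i\<in>{1..n}. v (swap_pairs n \<sigma> i) * u (swap_pairs n \<sigma> (n+i)))"
      unfolding pair_weight_def by (intro prod.cong) (auto simp: v_def u_def)
    also have "\<dots> = (\<Prod>i\<in>{1..n}-\<sigma>. v (swap_pairs n \<sigma> i) * u (swap_pairs n \<sigma> (n+i)))
       * (\<Prod>i\<in>\<sigma>. v (swap_pairs n \<sigma> i) * u (swap_pairs n \<sigma> (n+i)))"
      using s by (intro prod.subset_diff) auto
    also have "(\<Prod>i\<in>\<sigma>. v (swap_pairs n \<sigma> i) * u (swap_pairs n \<sigma> (n+i))) = (\<Prod>i\<in>\<sigma>. v (n+i) * u i)"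
      using s by (intro prod.cong) (auto simp: swap_pairs_def)
    also have "(\<Prod>i\<in>{1..n}-\<sigma>. v (swap_pairs n \<sigma> i) * u (swap_pairs n \<sigma> (n+i))) = (\<Prod>i\<in>{1..n}-\<sigma>. v i * u (n+i))"
      using s by (intro prod.cong) (auto simp: swap_pairs_def)
    finally show ?thesis by (simp add: mult.commute)
  qed
  have "(\<Sum>\<sigma>\<in>Pow {1..n}. pair_weight n {j \<in> {1..2*n}. swap_pairs n \<sigma> j \<in> p}) =
     (\<Sum>\<sigma>\<in>Pow {1..n}. (\<Prod>i\<in>\<sigma>. v (n+i) * u i) * (\<Prod>i\<in>{1..n}-\<sigma>. v i * u (n+i)))"
    by (intro sum.cong refl *) auto
  also have "\<dots> = (\<Prod>i\<in>{1..n}. v (n+i) * u i + v i * u (n+i))"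
    by (subst prod_add) auto
  also have "\<dots> \<le> (\<Prod>i\<in>{1..n}. 2)"
    by (intro prod_mono) (auto simp: u_def v_def)
  finally show ?thesis by simp
qed

lemma pair_weight_nonneg: "pair_weight n p \<ge> 0"
  unfolding pair_weight_def by (intro prod_nonneg) auto

lemma measurable_pair_weight:
  assumes "A \<in> sets P"
  shows "(\<lambda>w. ennreal (pair_weight n (hits {1..2*n} w A))) \<in> borel_measurable (PiM {1..2*n} (\<lambda>_. P))"
proof -
  have [measurable]: "A \<in> sets P" by fact
  have "(\<lambda>w. pair_weight n (hits {1..2*n} w A)) =
     (\<lambda>w. \<Prod>i\<in>{1..n}. (if w i \<in> A then 1/2 else 1) * (if w (n + i) \<in> A then 3/2 else 1))"
    unfolding pair_weight_def hits_def by (intro ext prod.cong) auto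
  moreover have "\<dots> \<in> borel_measurable (PiM {1..2*n} (\<lambda>_. P))"
  proof (intro borel_measurable_prod borel_measurable_times measurable_If)
    fix i assume "i \<in> {1..n}"
    then have 1: "i \<in> {1..2*n}" "n + i \<in> {1..2*n}" by auto
    have [measurable]: "(\<lambda>w. w i) \<in> measurable (PiM {1..2*n} (\<lambda>_. P)) P"
        "(\<lambda>w. w (n+i)) \<in> measurable (PiM {1..2*n} (\<lambda>_. P)) P"
      using 1 by (auto intro!: measurable_component_singleton)
    show "{w \<in> space (PiM {1..2*n} (\<lambda>_. P)). w i \<in> A} \<in> sets (PiM {1..2*n} (\<lambda>_. P))"
      by measurable
    show "{w \<in> space (PiM {1..2*n} (\<lambda>_. P)). w (n+i) \<in> A} \<in> sets (PiM {1..2*n} (\<lambda>_. P))"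
      by measurable
  qed auto
  ultimately have "(\<lambda>w. pair_weight n (hits {1..2*n} w A)) \<in> borel_measurable (PiM {1..2*n} (\<lambda>_. P))"
    by metis
  then show ?thesis by (rule measurable_compose) (rule measurable_ennreal)
qed

text \<open>Exchanging the points of pairs preserves the product measure, so the integrand may be
  averaged over all \<open>2 ^ n\<close> exchanges. For fixed points the supremum runs over the finitely many
  hit patterns and is at most the sum over them, each pattern contributing at most \<open>1\<close> on average.\<close>

lemma nn_integral_Sup_pair_weight_le:
  fixes P :: "'z measure"
  assumes P: "prob_space P" and \<A>: "countable \<A>" "\<A> \<subseteq> sets P"
    and card: "\<And>w. w \<in> {1..2*n} \<rightarrow> space P \<Longrightarrow> real (card (hits {1..2*n} w ` \<A>)) \<le> N"
  shows "(\<integral>\<^sup>+w. (SUP A\<in>\<A>. ennreal (pair_weight n (hits {1..2*n} w A))) \<partial>PiM {1..2*n} (\<lambda>_. P)) \<le> ennreal N"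
    (is "(\<integral>\<^sup>+w. ?F w \<partial>?M) \<le> _")
proof -
  interpret P: prob_space P by fact
  interpret M: prob_space ?M by (intro prob_space_PiM P)
  define T where "T \<sigma> = (\<lambda>w::nat\<Rightarrow>'z. \<lambda>j\<in>{1..2*n}. w (swap_pairs n \<sigma> j))" for \<sigma>
  have F[measurable]: "?F \<in> borel_measurable ?M"
    using \<A> by (intro borel_measurable_SUP measurable_pair_weight) auto
  have T: "distr ?M ?M (T \<sigma>) = ?M" "T \<sigma> \<in> measurable ?M ?M" if s: "\<sigma> \<subseteq> {1..n}" for \<sigma>
  proof -
    show "distr ?M ?M (T \<sigma>) = ?M"
      unfolding T_def using distr_PiM_reindex[of "{1..2*n}" "\<lambda>_. P" "swap_pairs n \<sigma>" "{1..2*n}"]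
        P swap_pairs_inj[OF s] swap_pairs_in[OF s] by auto
    show "T \<sigma> \<in> measurable ?M ?M" unfolding T_def using swap_pairs_in[OF s]
      by (intro measurable_restrict measurable_component_singleton) auto
  qed
  have inv: "(\<integral>\<^sup>+w. ?F (T \<sigma> w) \<partial>?M) = (\<integral>\<^sup>+w. ?F w \<partial>?M)" if s: "\<sigma> \<subseteq> {1..n}" for \<sigma>
    using nn_integral_distr[OF T(2)[OF s], of ?F] T[OF s] F by simp
  have pt: "(\<Sum>\<sigma>\<in>Pow {1..n}. ?F (T \<sigma> w)) \<le> 2 ^ n * ennreal N" if w: "w \<in> space ?M" for w
  proof -
    let ?J = "{1..2*n}"
    let ?X = "hits ?J w ` \<A>"
    define G where "G \<sigma> p = ennreal (pair_weight n {j\<in>?J. swap_pairs n \<sigma> j \<in> p})" for \<sigma> p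
    have fin: "finite ?X" by (rule finite_subset[of _ "Pow ?J"]) (auto simp: hits_def)
    have "w \<in> ?J \<rightarrow> space P" using w by (auto simp: space_PiM)
    then have cX: "real (card ?X) \<le> N" by (rule card)
    have "?F (T \<sigma> w) \<le> (\<Sum>p\<in>?X. G \<sigma> p)" if s: "\<sigma> \<in> Pow {1..n}" for \<sigma>
    proof (rule SUP_least)
      fix A assume A: "A \<in> \<A>"
      have "hits ?J (T \<sigma> w) A = {j\<in>?J. swap_pairs n \<sigma> j \<in> hits ?J w A}"
        using swap_pairs_in[of \<sigma> n] s unfolding hits_def T_def by auto
      then have "ennreal (pair_weight n (hits ?J (T \<sigma> w) A)) = G \<sigma> (hits ?J w A)" by (simp add: G_def)
      also have "\<dots> \<le> (\<Sum>p\<in>?X. G \<sigma> p)" using A fin by (intro member_le_sum) auto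
      finally show "ennreal (pair_weight n (hits ?J (T \<sigma> w) A)) \<le> (\<Sum>p\<in>?X. G \<sigma> p)" .
    qed
    then have "(\<Sum>\<sigma>\<in>Pow {1..n}. ?F (T \<sigma> w)) \<le> (\<Sum>\<sigma>\<in>Pow {1..n}. \<Sum>p\<in>?X. G \<sigma> p)"
      by (rule sum_mono)
    also have "\<dots> = (\<Sum>p\<in>?X. \<Sum>\<sigma>\<in>Pow {1..n}. G \<sigma> p)" by (rule sum.swap)
    also have "\<dots> \<le> (\<Sum>p\<in>?X. 2 ^ n)"
    proof (rule sum_mono)
      fix p
      have "(\<Sum>\<sigma>\<in>Pow {1..n}. G \<sigma> p) = ennreal (\<Sum>\<sigma>\<in>Pow {1..n}. pair_weight n {j \<in> ?J. swap_pairs n \<sigma> j \<in> p})"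
        unfolding G_def by (rule sum_ennreal) (rule pair_weight_nonneg)
      also have "\<dots> \<le> ennreal (2 ^ n)" by (intro ennreal_leI sum_swapped_pair_weight_le)
      finally show "(\<Sum>\<sigma>\<in>Pow {1..n}. G \<sigma> p) \<le> 2 ^ n" by (simp add: ennreal_power[symmetric])
    qed
    also have "\<dots> = 2 ^ n * ennreal (real (card ?X))"
      by (simp add: mult.commute ennreal_of_nat_eq_real_of_nat)
    also have "\<dots> \<le> 2 ^ n * ennreal N" using cX by (intro mult_left_mono ennreal_leI) auto
    finally show ?thesis .
  qed
  have "2 ^ n * (\<integral>\<^sup>+w. ?F w \<partial>?M) = (\<Sum>\<sigma>\<in>Pow {1..n}. (\<integral>\<^sup>+w. ?F (T \<sigma> w) \<partial>?M))"
    using inv by (simp add: card_Pow)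
  also have "\<dots> = (\<integral>\<^sup>+w. (\<Sum>\<sigma>\<in>Pow {1..n}. ?F (T \<sigma> w)) \<partial>?M)"
    using measurable_compose[OF T(2) F] by (intro nn_integral_sum[symmetric]) auto
  also have "\<dots> \<le> (\<integral>\<^sup>+w. 2 ^ n * ennreal N \<partial>?M)"
    by (intro nn_integral_mono pt)
  also have "\<dots> = 2 ^ n * ennreal N" using M.emeasure_space_1 by (simp del: One_nat_def)
  finally show ?thesis
    by (subst (asm) ennreal_mult_le_mult_iff) (auto simp: power_eq_top_ennreal)
qed

text \<open>What remains of \<open>pair_weight\<close> after integration over the ghost sample.\<close>

definition sample_weight :: "nat \<Rightarrow> 'z measure \<Rightarrow> (nat \<Rightarrow> 'z) \<Rightarrow> 'z set \<Rightarrow> real" where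
  "sample_weight n P z A = (1 + measure P A / 2) ^ n * (1/2) ^ card {i\<in>{1..n}. z i \<in> A}"

lemma sample_weight_alt:
  "sample_weight n P z A = (1 + measure P A / 2) ^ n * (\<Prod>i\<in>{1..n}. if z i \<in> A then 1/2 else 1)"
proof -
  have "(\<Prod>i\<in>{1..n}. if z i \<in> A then 1/2 else 1) = (\<Prod>i\<in>{i\<in>{1..n}. z i \<in> A}. (1/2::real))"
    by (subst prod.inter_filter) auto
  then show ?thesis by (simp add: sample_weight_def)
qed

lemma measurable_sample_weight:
  assumes "A \<in> sets P"
  shows "(\<lambda>w. ennreal (sample_weight n P w A)) \<in> borel_measurable (PiM {1..n} (\<lambda>_. P))"
proof -
  have [measurable]: "A \<in> sets P" by fact
  have "(\<lambda>w. \<Prod>i\<in>{1..n}. (if w i \<in> A then 1/2 else 1::real)) \<in> borel_measurable (PiM {1..n} (\<lambda>_. P))"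
  proof (intro borel_measurable_prod measurable_If)
    fix i assume "i \<in> {1..n}"
    then have [measurable]: "(\<lambda>w. w i) \<in> measurable (PiM {1..n} (\<lambda>_. P)) P"
      by (auto intro!: measurable_component_singleton)
    show "{w \<in> space (PiM {1..n} (\<lambda>_. P)). w i \<in> A} \<in> sets (PiM {1..n} (\<lambda>_. P))"
      by measurable
  qed auto
  then show ?thesis unfolding sample_weight_alt by measurable
qed

text \<open>Integrating the product weight over the ghost sample factorizes and gives the factor
  \<open>(1 + P A / 2) ^ n\<close> exactly, so the supremum of the integrals is bounded by the integral of the
  supremum, which is controlled by symmetrization.\<close>

lemma nn_integral_Sup_sample_weight_le:
  fixes P :: "'z measure"
  assumes P: "prob_space P" and \<A>: "countable \<A>" "\<A> \<subseteq> sets P"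
    and card: "\<And>w. w \<in> {1..2*n} \<rightarrow> space P \<Longrightarrow> real (card (hits {1..2*n} w ` \<A>)) \<le> N"
  shows "(\<integral>\<^sup>+z. (SUP A\<in>\<A>. ennreal (sample_weight n P z A)) \<partial>PiM {1..n} (\<lambda>_. P)) \<le> ennreal N"
proof -
  interpret P: prob_space P by fact
  interpret PS: product_sigma_finite "\<lambda>_::nat. P" by standard
  let ?I = "{1..n}" and ?I' = "{n+1..2*n}" and ?J = "{1..2*n}"
  have IJ: "?I \<union> ?I' = ?J" "?I \<inter> ?I' = {}" by auto
  let ?F = "\<lambda>w. SUP A\<in>\<A>. ennreal (pair_weight n (hits ?J w A))"
  have F: "?F \<in> borel_measurable (PiM (?I \<union> ?I') (\<lambda>_. P))"
    unfolding IJ using \<A> by (intro borel_measurable_SUP measurable_pair_weight) auto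
  have ghost: "(\<integral>\<^sup>+y. ennreal (pair_weight n (hits ?J (merge ?I ?I' (x, y)) A)) \<partial>PiM ?I' (\<lambda>_. P))
      = ennreal (sample_weight n P x A)" if A: "A \<in> \<A>" for A x
  proof -
    have As[measurable]: "A \<in> sets P" using A \<A> by auto
    let ?c = "\<Prod>i\<in>?I. if x i \<in> A then 1/2 else 1 :: real"
    have c0: "0 \<le> ?c" by (intro prod_nonneg) auto
    have *: "ennreal (pair_weight n (hits ?J (merge ?I ?I' (x, y)) A)) =
        ennreal ?c * (\<Prod>i\<in>?I'. if y i \<in> A then ennreal (3/2) else 1)" for y
    proof -
      have "pair_weight n (hits ?J (merge ?I ?I' (x, y)) A) =
         (\<Prod>i\<in>?I. (if x i \<in> A then 1/2 else 1) * (if y (n+i) \<in> A then 3/2 else 1))"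
        unfolding pair_weight_def hits_def by (intro prod.cong) (auto simp: merge_def)
      also have "\<dots> = ?c * (\<Prod>i\<in>?I. if y (n+i) \<in> A then 3/2 else 1)"
        by (rule prod.distrib)
      also have "(\<Prod>i\<in>?I. if y (n+i) \<in> A then 3/2 else 1::real) = (\<Prod>i\<in>?I'. if y i \<in> A then 3/2 else 1)"
        by (rule prod.reindex_bij_witness[of _ "\<lambda>i. i - n" "\<lambda>i. n + i"]) auto
      finally have "ennreal (pair_weight n (hits ?J (merge ?I ?I' (x, y)) A)) =
         ennreal ?c * ennreal (\<Prod>i\<in>?I'. if y i \<in> A then 3/2 else 1)"
        using c0 by (simp add: ennreal_mult prod_nonneg)
      also have "ennreal (\<Prod>i\<in>?I'. if y i \<in> A then 3/2 else 1) = (\<Prod>i\<in>?I'. if y i \<in> A then ennreal (3/2) else 1)"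
        by (subst prod_ennreal[symmetric]) (auto intro!: prod.cong)
      finally show ?thesis .
    qed
    have three_halves: "1 + ennreal (1/2) = ennreal (3/2)"
      by (subst ennreal_1[symmetric], subst ennreal_plus[symmetric]) auto
    have one: "(\<integral>\<^sup>+z. (if z \<in> A then ennreal (3/2) else 1) \<partial>P) = ennreal (1 + measure P A / 2)"
    proof -
      have "(\<integral>\<^sup>+z. (if z \<in> A then ennreal (3/2) else 1) \<partial>P) = (\<integral>\<^sup>+z. 1 + ennreal (1/2) * indicator A z \<partial>P)"
        using three_halves by (intro nn_integral_cong) (auto simp del: ennreal_half)
      also have "\<dots> = 1 + ennreal (1/2) * emeasure P A"
        by (subst nn_integral_add) (auto simp: nn_integral_cmult P.emeasure_space_1)
      also have "\<dots> = ennreal (1 + measure P A / 2)"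
        unfolding P.emeasure_eq_measure
        by (subst ennreal_1[symmetric], subst ennreal_mult[symmetric], simp, simp,
            subst ennreal_plus[symmetric]) auto
      finally show ?thesis .
    qed
    have "(\<integral>\<^sup>+y. ennreal (pair_weight n (hits ?J (merge ?I ?I' (x, y)) A)) \<partial>PiM ?I' (\<lambda>_. P)) =
       (\<integral>\<^sup>+y. ennreal ?c * (\<Prod>i\<in>?I'. if y i \<in> A then ennreal (3/2) else 1) \<partial>PiM ?I' (\<lambda>_. P))"
      by (simp only: *)
    also have "\<dots> = ennreal ?c * (\<integral>\<^sup>+y. (\<Prod>i\<in>?I'. if y i \<in> A then ennreal (3/2) else 1) \<partial>PiM ?I' (\<lambda>_. P))"
      by (intro nn_integral_cmult borel_measurable_prod) measurable
    also have "(\<integral>\<^sup>+y. (\<Prod>i\<in>?I'. if y i \<in> A then ennreal (3/2) else 1) \<partial>PiM ?I' (\<lambda>_. P)) =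
       (\<Prod>i\<in>?I'. (\<integral>\<^sup>+z. (if z \<in> A then ennreal (3/2) else 1) \<partial>P))"
      by (rule PS.product_nn_integral_prod) auto
    also have "\<dots> = ennreal ((1 + measure P A / 2) ^ n)"
      unfolding one by (simp add: ennreal_power del: ennreal_plus)
    finally show ?thesis using c0
      by (simp add: sample_weight_alt ennreal_mult[symmetric] mult.commute)
  qed
  have "(\<integral>\<^sup>+x. (SUP A\<in>\<A>. ennreal (sample_weight n P x A)) \<partial>PiM ?I (\<lambda>_. P)) \<le>
     (\<integral>\<^sup>+x. \<integral>\<^sup>+y. ?F (merge ?I ?I' (x, y)) \<partial>PiM ?I' (\<lambda>_. P) \<partial>PiM ?I (\<lambda>_. P))"
  proof (intro nn_integral_mono SUP_least)
    fix x A assume A: "A \<in> \<A>"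
    show "ennreal (sample_weight n P x A) \<le> (\<integral>\<^sup>+y. ?F (merge ?I ?I' (x, y)) \<partial>PiM ?I' (\<lambda>_. P))"
      unfolding ghost[OF A, symmetric] by (intro nn_integral_mono SUP_upper A)
  qed
  also have "\<dots> = (\<integral>\<^sup>+w. ?F w \<partial>PiM (?I \<union> ?I') (\<lambda>_. P))"
    by (rule PS.product_nn_integral_fold[symmetric]) (use IJ F in auto)
  also have "\<dots> \<le> ennreal N"
    unfolding IJ using assms by (rule nn_integral_Sup_pair_weight_le)
  finally show ?thesis .
qed

text \<open>The Markov inequality for the supremum of \<open>sample_weight\<close>, summed over the classes with
  weights \<open>(1/2) ^ (m + 1) / N m\<close>, which makes the inequality hold for all classes at once.
  Because the weights are multiplicative, taking logarithms gives a deviation term of order \<open>1/n\<close>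
  instead of its square root, at the price of the factor \<open>3\<close> on the empirical frequency.\<close>

lemma relative_deviation_uniform:
  fixes P :: "'z measure" and \<Omega> :: "'w measure"
  assumes P: "prob_space P" and \<Omega>: "prob_space \<Omega>" and n: "n \<ge> 1"
    and indep: "prob_space.indep_vars \<Omega> (\<lambda>_. P) Z {1..n}"
    and distr: "\<And>i. i \<in> {1..n} \<Longrightarrow> distr \<Omega> P (Z i) = P"
    and \<A>: "\<And>m. countable (\<A> m)" "\<And>m. \<A> m \<subseteq> sets P"
    and N: "\<And>m::nat. N m > 0"
    and card: "\<And>m w. w \<in> {1..2*n} \<rightarrow> space P \<Longrightarrow> real (card (hits {1..2*n} w ` \<A> m)) \<le> N m"
  shows "\<exists>E\<in>sets \<Omega>. measure \<Omega> E \<ge> 1 - exp (-t) \<and>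
    (\<forall>\<omega>\<in>E. \<forall>m. \<forall>A\<in>\<A> m. measure P A \<le>
        3 * (real (card {i\<in>{1..n}. Z i \<omega> \<in> A}) / real n) + 3 * (ln (N m) + (real m + 1) * ln 2 + t) / real n)"
proof -
  interpret P: prob_space P by fact
  interpret O: prob_space \<Omega> by fact
  let ?I = "{1..n}" and ?M = "PiM {1..n} (\<lambda>_. P)"
  have Zm[measurable]: "\<And>i. i \<in> ?I \<Longrightarrow> Z i \<in> measurable \<Omega> P"
    using indep unfolding O.indep_vars_def by auto
  define Y where "Y = (\<lambda>\<omega>. \<lambda>i\<in>?I. Z i \<omega>)"
  have Ym[measurable]: "Y \<in> measurable \<Omega> ?M"
    unfolding Y_def by (intro measurable_restrict Zm)
  have "distr \<Omega> ?M Y = (\<Pi>\<^sub>M i\<in>?I. distr \<Omega> P (Z i))"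
    unfolding Y_def by (rule O.indep_vars_iff_distr_eq_PiM'[THEN iffD1]) (use n indep Zm in auto)
  also have "\<dots> = ?M" using distr by (intro PiM_cong) auto
  finally have dY: "distr \<Omega> ?M Y = ?M" .
  let ?S = "\<lambda>m z. SUP A\<in>\<A> m. ennreal (sample_weight n P z A)"
  let ?c = "\<lambda>m::nat. ennreal ((1/2)^(Suc m) / N m)"
  define F where "F z = (\<Sum>m. ?c m * ?S m z)" for z
  have S: "?S m \<in> borel_measurable ?M" for m
    using \<A> by (intro borel_measurable_SUP measurable_sample_weight) auto
  then have F[measurable]: "F \<in> borel_measurable ?M" unfolding F_def
    by (intro borel_measurable_suminf_order borel_measurable_times_ennreal borel_measurable_const)
  have "(\<integral>\<^sup>+z. F z \<partial>?M) = (\<Sum>m. \<integral>\<^sup>+z. ?c m * ?S m z \<partial>?M)"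
    unfolding F_def by (intro nn_integral_suminf borel_measurable_times_ennreal borel_measurable_const S)
  also have "\<dots> = (\<Sum>m. ?c m * \<integral>\<^sup>+z. ?S m z \<partial>?M)"
    by (intro suminf_cong nn_integral_cmult S)
  also have "\<dots> \<le> (\<Sum>m. ennreal ((1/2)^(Suc m)))"
  proof (intro suminf_le summableI)
    fix m
    have "?c m * (\<integral>\<^sup>+z. ?S m z \<partial>?M) \<le> ?c m * ennreal (N m)"
      by (intro mult_left_mono nn_integral_Sup_sample_weight_le P \<A> card) auto
    also have "\<dots> = ennreal ((1/2)^(Suc m))"
      using N[of m] by (subst ennreal_mult[symmetric]) auto
    finally show "?c m * (\<integral>\<^sup>+z. ?S m z \<partial>?M) \<le> ennreal ((1/2)^(Suc m))" .
  qed
  also have "\<dots> = ennreal 1"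
    using power_half_series by (subst suminf_ennreal_eq[where x=1]) auto
  finally have F1: "(\<integral>\<^sup>+z. F z \<partial>?M) \<le> 1" by simp
  define E where "E = {\<omega>\<in>space \<Omega>. F (Y \<omega>) < ennreal (exp t)}"
  have Es: "E \<in> sets \<Omega>" unfolding E_def by measurable
  have "emeasure \<Omega> (space \<Omega> - E) \<le> ennreal (exp (-t))"
  proof -
    have "space \<Omega> - E = {\<omega>\<in>space \<Omega>. 1 \<le> ennreal (exp (-t)) * F (Y \<omega>)}"
    proof -
      have "1 \<le> ennreal (exp (-t)) * x \<longleftrightarrow> ennreal (exp t) \<le> x" for x
      proof -
        have "ennreal (exp (-t)) * ennreal (exp t) = 1"
          by (simp add: ennreal_mult[symmetric] exp_minus)
        then have "1 \<le> ennreal (exp (-t)) * x \<longleftrightarrow> ennreal (exp (-t)) * ennreal (exp t) \<le> ennreal (exp (-t)) * x" by simp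
        also have "\<dots> \<longleftrightarrow> ennreal (exp t) \<le> x" by (subst ennreal_mult_le_mult_iff) auto
        finally show ?thesis .
      qed
      then show ?thesis unfolding E_def by (simp only: not_less[symmetric]) blast
    qed
    also have "emeasure \<Omega> \<dots> \<le> ennreal (exp (-t)) * (\<integral>\<^sup>+\<omega>. F (Y \<omega>) * indicator (space \<Omega>) \<omega> \<partial>\<Omega>)"
      by (rule nn_integral_Markov_inequality) auto
    also have "(\<integral>\<^sup>+\<omega>. F (Y \<omega>) * indicator (space \<Omega>) \<omega> \<partial>\<Omega>) = (\<integral>\<^sup>+\<omega>. F (Y \<omega>) \<partial>\<Omega>)"
      by (intro nn_integral_cong) auto
    also have "\<dots> = (\<integral>\<^sup>+z. F z \<partial>distr \<Omega> ?M Y)" by (rule nn_integral_distr[OF Ym, symmetric]) (use F in simp)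
    also have "\<dots> \<le> 1" unfolding dY by (rule F1)
    finally show ?thesis by (simp add: mult_left_mono)
  qed
  then have "measure \<Omega> (space \<Omega> - E) \<le> exp (-t)"
    by (simp add: O.emeasure_eq_measure)
  then have EP: "measure \<Omega> E \<ge> 1 - exp (-t)" using O.prob_compl[OF Es] by simp
  show ?thesis
  proof (intro bexI[of _ E] conjI EP Es ballI allI)
    fix \<omega> m A assume w: "\<omega> \<in> E" and A: "A \<in> \<A> m"
    let ?k = "card {i\<in>?I. Z i \<omega> \<in> A}" and ?p = "measure P A"
    have k: "{i\<in>?I. Y \<omega> i \<in> A} = {i\<in>?I. Z i \<omega> \<in> A}" by (auto simp: Y_def)
    have "?c m * ennreal (sample_weight n P (Y \<omega>) A) \<le> ?c m * ?S m (Y \<omega>)"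
      by (intro mult_left_mono SUP_upper A) auto
    also have "\<dots> \<le> F (Y \<omega>)"
      unfolding F_def using sum_le_suminf[OF summableI, of "{m}" "\<lambda>m. ?c m * ?S m (Y \<omega>)"] by simp
    also have "\<dots> < ennreal (exp t)" using w by (simp add: E_def)
    finally have "((1/2)^(Suc m) / N m) * sample_weight n P (Y \<omega>) A < exp t"
      using N[of m] by (simp add: ennreal_mult[symmetric] sample_weight_def ennreal_less_iff)
    then have "(1 + ?p / 2) ^ n * (1/2) ^ ?k < exp t * N m * 2 ^ (m+1)"
      using N[of m] unfolding sample_weight_def k by (simp add: field_simps)
    then have "ln ((1 + ?p / 2) ^ n * (1/2) ^ ?k) < ln (exp t * N m * 2 ^ (m+1))"
      using N[of m] by (subst ln_less_cancel_iff) (auto intro!: mult_pos_pos zero_less_power add_pos_nonneg)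
    moreover have "ln ((1 + ?p / 2) ^ n * (1/2) ^ ?k) = n * ln (1 + ?p/2) - ?k * ln 2"
    proof -
      have "1 + ?p / 2 > 0" by (intro add_pos_nonneg) auto
      then have "(1 + ?p / 2) ^ n > 0" "ln ((1 + ?p / 2) ^ n) = n * ln (1 + ?p/2)"
        by (auto simp: ln_realpow)
      moreover have "ln ((1/2) ^ ?k) = - (?k * ln 2 :: real)" by (simp add: ln_realpow ln_div)
      ultimately show ?thesis by (subst ln_mult_pos) auto
    qed
    moreover have "ln (exp t * N m * 2 ^ (m+1)) = t + ln (N m) + (real m + 1) * ln 2"
    proof -
      have "ln ((2::real) ^ (m+1)) = (real m + 1) * ln 2" by (subst ln_realpow) simp
      then show ?thesis using N[of m] by (subst ln_mult_pos, simp, simp, subst ln_mult_pos) auto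
    qed
    ultimately have "n * ln (1 + ?p/2) - ?k * ln 2 < t + ln (N m) + (real m + 1) * ln 2" by simp
    moreover have "?p / 3 \<le> ln (1 + ?p / 2)"
    proof -
      \<comment> \<open>Uses \<open>?p \<le> 1\<close>; then \<open>ln (1 + x) \<ge> x / (1 + x)\<close> applies.\<close>
      have "?p / 3 \<le> (?p/2) / (1 + ?p/2)"
      proof -
        have "?p * ?p \<le> 1 * ?p" by (intro mult_right_mono) auto
        moreover have "0 < 1 + ?p/2" by (intro add_pos_nonneg) auto
        ultimately show ?thesis by (simp add: field_simps)
      qed
      also have "\<dots> = 1 - 1 / (1 + ?p/2)" 
      proof -
        have "0 < 1 + ?p/2" by (intro add_pos_nonneg) auto
        then show ?thesis by (simp add: field_simps)
      qed
      also have "\<dots> \<le> ln (1 + ?p/2)"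
      proof -
        have "1 - 1 / x \<le> ln x" if "x > 0" for x :: real
          using ln_le_minus_one[of "1/x"] that by (simp add: ln_div)
        then show ?thesis by (simp add: add_pos_nonneg)
      qed
      finally show ?thesis .
    qed
    then have "n * (?p/3) \<le> n * ln (1 + ?p/2)" by (intro mult_left_mono) auto
    moreover have "?k * ln 2 \<le> ?k * (1::real)" using ln_2_less_1 by (intro mult_left_mono) auto
    ultimately have "n * ?p \<le> 3 * real ?k + 3 * (ln (N m) + (real m + 1) * ln 2 + t)" by argo
    then show "?p \<le> 3 * (real ?k / real n) + 3 * (ln (N m) + (real m + 1) * ln 2 + t) / real n"
      using n by (simp add: field_simps)
  qed
qed

section \<open>Weighted votes and their number of patterns on a sample\<close>

text \<open>Two functions that differ at one of the \<open>2n\<close> points have squared empirical distance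
  at least \<open>4/(2n)\<close>, which exceeds \<open>1/n\<close>. Hence a ball of radius at most \<open>1/\<surd>n\<close> contains a
  single pattern, that of its centre. The radius is also at most \<open>u0\<close>, where the covering bound
  is available.\<close>

lemma finite_patterns_card_le:
  fixes n :: nat and x :: "nat \<Rightarrow> 'a"
  assumes cov: "uniform_covering_bound M H V A u0" and u0: "u0 > 0" and n: "n \<ge> 1"
    and x: "x \<in> {1..2*n} \<rightarrow> space M" and pm: "\<And>h y. h \<in> H \<Longrightarrow> y \<in> space M \<Longrightarrow> h y \<in> {-1, 1}"
  shows "finite ((\<lambda>h. \<lambda>j\<in>{1..2*n}. h (x j)) ` H) \<and>
     real (card ((\<lambda>h. \<lambda>j\<in>{1..2*n}. h (x j)) ` H)) \<le> A * min u0 (1 / sqrt n) powr (-V)"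
proof -
  let ?J = "{1..2*n}"
  let ?pat = "\<lambda>h. \<lambda>j\<in>?J. h (x j)"
  define u where "u = min u0 (1 / sqrt n)"
  have u: "0 < u" "u \<le> u0" "u \<le> 1 / sqrt n" using u0 n by (auto simp: u_def)
  define Q where "Q = map_pmf x (pmf_of_set ?J)"
  have J: "finite ?J" "?J \<noteq> {}" using n by simp_all
  have Q: "Q \<in> discrete_distributions M"
    unfolding discrete_distributions_def Q_def using x J by (auto simp: set_pmf_of_set)
  have "ereal_of_enat (covering_number (L2_dist (measure_pmf Q)) H u) \<le>
      ereal_of_enat (SUP Q\<in>discrete_distributions M. covering_number (L2_dist (measure_pmf Q)) H u)"
    unfolding ereal_of_enat_le_iff by (rule SUP_upper[OF Q])
  also have "\<dots> \<le> ereal (A * u powr (-V))"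
    by (rule cov[unfolded uniform_covering_bound_def, rule_format]) (use u in simp)
  finally have "ereal_of_enat (covering_number (L2_dist (measure_pmf Q)) H u) \<le> ereal (A * u powr (-V))" .
  then obtain k where k: "covering_number (L2_dist (measure_pmf Q)) H u = enat k"
      "real k \<le> A * u powr (-V)"
    by (cases "covering_number (L2_dist (measure_pmf Q)) H u") auto
  have "covering_number (L2_dist (measure_pmf Q)) H u < enat (Suc k)" using k by simp
  then obtain S where S: "finite S" "S \<subseteq> H" "H \<subseteq> (\<Union>c\<in>S. {g. L2_dist (measure_pmf Q) c g \<le> u})"
      "card S \<le> k"
    unfolding covering_number_def INF_less_iff by auto
  have eq: "c (x j) = g (x j)" if c: "c \<in> H" and g: "g \<in> H" and d: "L2_dist (measure_pmf Q) c g \<le> u"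
      and j: "j \<in> ?J" for c g j
  proof (rule ccontr)
    assume ne: "c (x j) \<noteq> g (x j)"
    have "x j \<in> space M" using x j by auto
    then have "c (x j) \<in> {-1,1}" "g (x j) \<in> {-1,1}" using pm c g by blast+
    then have "4 = (c (x j) - g (x j))\<^sup>2" using ne by auto
    also have "(c (x j) - g (x j))\<^sup>2 \<le> (\<Sum>j\<in>?J. (c (x j) - g (x j))\<^sup>2)"
      using j by (intro member_le_sum[of j ?J "\<lambda>j. (c (x j) - g (x j))\<^sup>2"]) auto
    finally have "4 / (2 * real n) \<le> (\<Sum>j\<in>?J. (c (x j) - g (x j))\<^sup>2) / (2 * real n)"
      by (intro divide_right_mono) auto
    also have "\<dots> = (\<integral>y. (c y - g y)\<^sup>2 \<partial>measure_pmf Q)"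
      unfolding Q_def using J by (simp add: integral_pmf_of_set del: One_nat_def)
    also have "\<dots> = (L2_dist (measure_pmf Q) c g)\<^sup>2"
      by (simp add: L2_dist_def)
    also have "\<dots> \<le> (1 / sqrt n)\<^sup>2"
      using d u by (intro power_mono) (auto simp: L2_dist_def)
    finally have "2 / real n \<le> 1 / real n" by (simp add: power_divide)
    then show False using n by (simp add: field_simps)
  qed
  have sub: "?pat ` H \<subseteq> ?pat ` S"
  proof
    fix p assume "p \<in> ?pat ` H"
    then obtain g where g: "g \<in> H" "p = ?pat g" by blast
    then obtain c where c: "c \<in> S" "L2_dist (measure_pmf Q) c g \<le> u" using S by blast
    have "?pat c = ?pat g" using eq[OF _ g(1) c(2)] c(1) S(2) by (intro restrict_ext) auto
    then show "p \<in> ?pat ` S" using c(1) g(2) by (metis (no_types, lifting) image_eqI)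
  qed
  have fin: "finite (?pat ` H)" by (rule finite_subset[OF sub]) (use S in auto)
  have "card (?pat ` H) \<le> card (?pat ` S)" by (rule card_mono) (use S sub in auto)
  also have "\<dots> \<le> card S" using S by (intro card_image_le)
  finally have "real (card (?pat ` H)) \<le> real k" using S by simp
  with k fin show ?thesis unfolding u_def by simp
qed

definition signed :: "('a \<Rightarrow> real) set \<Rightarrow> ('a \<Rightarrow> real) set" where
  "signed H = {\<lambda>x. s * h x | s h. s \<in> {-1, 0, 1} \<and> h \<in> H}"

definition margin_set :: "('a \<times> real) measure \<Rightarrow> ('a \<Rightarrow> real) list \<Rightarrow> real \<Rightarrow> ('a \<times> real) set" where
  "margin_set P gs \<theta> = {z \<in> space P. snd z * (\<Sum>g\<leftarrow>gs. g (fst z)) \<le> \<theta>}"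

text \<open>Votes are sums without the factor \<open>1/m\<close>: they are integers, so the integer thresholds
  between \<open>0\<close> and \<open>m\<close> suffice to describe the margin sets that occur, and the family stays
  countable.\<close>

definition vote_sets :: "('a \<times> real) measure \<Rightarrow> ('a \<Rightarrow> real) set \<Rightarrow> nat \<Rightarrow> ('a \<times> real) set set" where
  "vote_sets P H m =
     (\<lambda>(gs, k). margin_set P gs (real k)) ` ({gs. set gs \<subseteq> signed H \<and> length gs = m} \<times> {..m})"

lemma signed_eq: "signed H = (\<lambda>(s, h). \<lambda>x. s * h x) ` ({-1, 0, 1} \<times> H)"
  unfolding signed_def by auto

lemma countable_vote_sets:
  assumes "countable H" shows "countable (vote_sets P H m)"
proof -
  have "countable (signed H)" unfolding signed_eq using assms by (intro countable_image countable_SIGMA) auto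
  then have "countable (lists (signed H))" by (rule countable_lists)
  then have "countable {gs. set gs \<subseteq> signed H \<and> length gs = m}"
    by (rule countable_subset[rotated]) auto
  then show ?thesis unfolding vote_sets_def by (intro countable_image countable_SIGMA) auto
qed

text \<open>A hit pattern is determined by the threshold and the patterns of the \<open>m\<close> voters; the
  factor \<open>3\<close> counts the signs.\<close>

lemma card_hits_vote_sets_le:
  assumes w: "w \<in> {1..2*n} \<rightarrow> space P"
    and fin: "finite ((\<lambda>h. \<lambda>j\<in>{1..2*n}. h (fst (w j))) ` H)"
    and card: "real (card ((\<lambda>h. \<lambda>j\<in>{1..2*n}. h (fst (w j))) ` H)) \<le> G"
  shows "real (card (hits {1..2*n} w ` vote_sets P H m)) \<le> (real m + 1) * (3 * G) ^ m"
proof -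
  let ?J = "{1..2*n}"
  let ?pat = "\<lambda>h. \<lambda>j\<in>?J. h (fst (w j))"
  let ?S = "?pat ` signed H"
  have S: "?S \<subseteq> (\<lambda>(s, p). \<lambda>j\<in>?J. s * p j) ` ({-1, 0, 1 :: real} \<times> ?pat ` H)"
  proof
    fix p assume "p \<in> ?S"
    then obtain s h where "s \<in> {-1, 0, 1}" "h \<in> H" "p = ?pat (\<lambda>x. s * h x)"
      unfolding signed_def by auto
    then have "(s, ?pat h) \<in> {-1, 0, 1} \<times> ?pat ` H" "p = (\<lambda>j\<in>?J. s * ?pat h j)"
      by (auto intro!: restrict_ext)
    then show "p \<in> (\<lambda>(s, p). \<lambda>j\<in>?J. s * p j) ` ({-1, 0, 1} \<times> ?pat ` H)" by force
  qed
  have finS: "finite ?S" by (rule finite_subset[OF S]) (use fin in auto)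
  have "card ?S \<le> card ((\<lambda>(s, p). \<lambda>j\<in>?J. s * p j) ` ({-1, 0, 1 :: real} \<times> ?pat ` H))"
    by (rule card_mono[OF _ S]) (use fin in auto)
  also have "\<dots> \<le> card ({-1, 0, 1 :: real} \<times> ?pat ` H)"
    by (rule card_image_le) (use fin in auto)
  also have "\<dots> = 3 * card (?pat ` H)" by (simp add: card_cartesian_product)
  finally have cS: "real (card ?S) \<le> 3 * G" using card by linarith
  let ?L = "{ps. set ps \<subseteq> ?S \<and> length ps = m} \<times> {..m}"
  let ?t = "\<lambda>(ps, k). {j\<in>?J. snd (w j) * (\<Sum>p\<leftarrow>ps. p j) \<le> real k}"
  have "hits ?J w ` vote_sets P H m \<subseteq> ?t ` ?L"
  proof
    fix q assume "q \<in> hits ?J w ` vote_sets P H m"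
    then obtain gs k where g: "set gs \<subseteq> signed H" "length gs = m" "k \<le> m"
        "q = hits ?J w (margin_set P gs (real k))"
      unfolding vote_sets_def by auto
    have "(\<Sum>p\<leftarrow>map ?pat gs. p j) = (\<Sum>g\<leftarrow>gs. g (fst (w j)))" if "j \<in> ?J" for j
      using that by (simp add: comp_def)
    then have "q = ?t (map ?pat gs, k)"
      unfolding g hits_def margin_set_def using w by auto
    moreover have "(map ?pat gs, k) \<in> ?L" using g by auto
    ultimately show "q \<in> ?t ` ?L" by (rule image_eqI)
  qed
  moreover have fL: "finite ?L" using finS by (intro finite_cartesian_product finite_lists_length_eq) auto
  ultimately have "card (hits ?J w ` vote_sets P H m) \<le> card (?t ` ?L)"
    by (intro card_mono finite_imageI)
  also have "\<dots> \<le> card ?L" using fL by (rule card_image_le)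
  also have "\<dots> = (m + 1) * card ?S ^ m"
    using card_lists_length_eq[OF finS, of m] by (simp add: card_cartesian_product)
  finally have "real (card (hits ?J w ` vote_sets P H m)) \<le> (real m + 1) * real (card ?S) ^ m"
    by (metis (mono_tags, lifting) of_nat_le_iff of_nat_mult of_nat_power of_nat_add of_nat_1)
  also have "\<dots> \<le> (real m + 1) * (3 * G) ^ m"
    using cS by (intro mult_left_mono power_mono) auto
  finally show ?thesis .
qed

lemma measurable_labels_cases:
  assumes "h \<in> measurable M labels" "x \<in> space M" shows "h x \<in> {-1, 1}"
  using measurable_space[OF assms] by (simp add: labels_def)

lemma measurable_labels_borel:
  assumes "h \<in> measurable M labels" shows "h \<in> borel_measurable M"
  using measurable_compose[OF assms, of "\<lambda>x. x" borel] by (simp add: labels_def)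

lemma sample_point_cases:
  assumes "sets P = sets (M \<Otimes>\<^sub>M labels)" "z \<in> space P"
  shows "fst z \<in> space M" "snd z \<in> {-1, 1}"
proof -
  have "z \<in> space (M \<Otimes>\<^sub>M labels)" using assms sets_eq_imp_space_eq by blast
  then show "fst z \<in> space M" "snd z \<in> {-1, 1}" by (auto simp: space_pair_measure labels_def)
qed

lemma measurable_margin:
  assumes P: "sets P = sets (M \<Otimes>\<^sub>M labels)" and g: "g \<in> borel_measurable M"
  shows "(\<lambda>z. snd z * g (fst z)) \<in> borel_measurable P"
proof -
  have 1: "fst \<in> measurable P M"
    unfolding measurable_cong_sets[OF P refl] by (rule measurable_fst)
  have 2: "snd \<in> measurable P labels"
    unfolding measurable_cong_sets[OF P refl] by (rule measurable_snd)
  show ?thesis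
    by (rule borel_measurable_times[OF measurable_labels_borel[OF 2] measurable_compose[OF 1 g]])
qed

lemma sconv_measurable:
  assumes H: "H \<subseteq> measurable M labels" and f: "f \<in> sconv H" shows "f \<in> borel_measurable M"
proof -
  obtain N l h where h: "\<And>i. i\<in>{1..N::nat} \<Longrightarrow> h i \<in> H" "f = (\<lambda>x. \<Sum>i=1..N. l i * h i x)"
    using f unfolding sconv_def by blast
  have "h i \<in> borel_measurable M" if "i \<in> {1..N}" for i
    using h(1)[OF that] H by (intro measurable_labels_borel) blast
  then show ?thesis unfolding h(2)
    by (intro borel_measurable_sum borel_measurable_times borel_measurable_const)
qed

lemma signed_measurable:
  assumes H: "H \<subseteq> measurable M labels" and g: "g \<in> signed H" shows "g \<in> borel_measurable M"
proof -
  obtain s h where s: "h \<in> H" "g = (\<lambda>x. s * h x)"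
    using g unfolding signed_def by blast
  then have "h \<in> borel_measurable M" using H by (intro measurable_labels_borel) blast
  then show ?thesis unfolding s(2) by (intro borel_measurable_times borel_measurable_const)
qed

lemma signed_votes_measurable:
  assumes "H \<subseteq> measurable M labels" "set gs \<subseteq> signed H"
  shows "(\<lambda>x. \<Sum>g\<leftarrow>gs. g x) \<in> borel_measurable M"
  using assms(2) by (induction gs) (auto intro!: borel_measurable_add intro: signed_measurable[OF assms(1)])

lemma margin_set_sets:
  assumes P: "sets P = sets (M \<Otimes>\<^sub>M labels)" and H: "H \<subseteq> measurable M labels" "set gs \<subseteq> signed H"
  shows "margin_set P gs \<theta> \<in> sets P"
proof -
  have [measurable]: "(\<lambda>z. snd z * (\<Sum>g\<leftarrow>gs. g (fst z))) \<in> borel_measurable P"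
    by (rule measurable_margin[OF P signed_votes_measurable[OF H]])
  show ?thesis unfolding margin_set_def by measurable
qed

lemma vote_sum_Ints:
  assumes P: "sets P = sets (M \<Otimes>\<^sub>M labels)" and H: "H \<subseteq> measurable M labels"
    and gs: "set gs \<subseteq> signed H" and z: "z \<in> space P"
  shows "snd z * (\<Sum>g\<leftarrow>gs. g (fst z)) \<in> \<int>"
proof -
  have "g (fst z) \<in> \<int>" if "g \<in> signed H" for g
  proof -
    obtain s h' where s: "s \<in> {-1, 0, 1}" "h' \<in> H" "g = (\<lambda>x. s * h' x)"
      using \<open>g \<in> signed H\<close> unfolding signed_def by blast
    have "h' (fst z) \<in> {-1, 1}"
      using measurable_labels_cases[of h' M] s(2) H sample_point_cases[OF P z] by blast
    then show ?thesis using s by auto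
  qed
  then have "(\<Sum>g\<leftarrow>gs. g (fst z)) \<in> \<int>" using gs by (induction gs) (auto intro!: Ints_add)
  moreover have "snd z \<in> \<int>" using sample_point_cases(2)[OF P z] by auto
  ultimately show ?thesis by (intro Ints_mult)
qed

text \<open>For integer votes a threshold may be rounded down.\<close>

lemma margin_set_in_vote_sets:
  assumes P: "sets P = sets (M \<Otimes>\<^sub>M labels)" and H: "H \<subseteq> measurable M labels"
    and gs: "set gs \<subseteq> signed H" "length gs = m" and \<theta>: "0 \<le> \<theta>" "\<theta> \<le> real m"
  shows "margin_set P gs \<theta> \<in> vote_sets P H m"
proof -
  have "q \<le> \<theta> \<longleftrightarrow> q \<le> real (nat \<lfloor>\<theta>\<rfloor>)" if "q \<in> \<int>" for q :: real
    using that \<theta> by (auto elim!: Ints_cases simp: le_floor_iff[symmetric])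
  then have "margin_set P gs \<theta> = margin_set P gs (real (nat \<lfloor>\<theta>\<rfloor>))"
    unfolding margin_set_def using vote_sum_Ints[OF P H gs(1)] by blast
  moreover have "nat \<lfloor>\<theta>\<rfloor> \<le> m" using \<theta> by linarith
  ultimately show ?thesis unfolding vote_sets_def using gs by force
qed

section \<open>Approximation of convex combinations by short votes\<close>

lemma exp_le_quadratic:
  fixes x :: real assumes "\<bar>x\<bar> \<le> 1" shows "exp x \<le> 1 + x + x\<^sup>2"
proof (cases "x \<ge> 0")
  case True then show ?thesis using exp_bound[of x] assms by simp
next
  case False
  define y where "y = -x"
  have y: "0 \<le> y" "y \<le> 1" using False assms by (auto simp: y_def)
  have "1 + y + y\<^sup>2/2 \<le> exp y" using y by (intro exp_lower_Taylor_quadratic) auto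
  moreover have "1 \<le> (1 - y + y\<^sup>2) * (1 + y + y\<^sup>2/2)"
  proof -
    have "(1 - y + y\<^sup>2) * (1 + y + y\<^sup>2/2) = 1 + (y^2 + y^3 + y^4)/2"
      by (simp add: field_simps power2_eq_square power3_eq_cube power4_eq_xxxx)
    then show ?thesis using y by simp
  qed
  moreover have "1 - y + y\<^sup>2 \<ge> 0" using y by simp
  ultimately have "1 \<le> (1 - y + y\<^sup>2) * exp y"
    by (meson mult_left_mono order_trans)
  then show ?thesis by (simp add: y_def exp_minus field_simps)
qed

lemma abs_convex_combination_le_one:
  fixes p v :: "'i \<Rightarrow> real"
  assumes p: "\<And>i. i \<in> K \<Longrightarrow> 0 \<le> p i" "(\<Sum>i\<in>K. p i) = 1"
    and v: "\<And>i. i \<in> K \<Longrightarrow> \<bar>v i\<bar> \<le> 1"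
  shows "\<bar>\<Sum>i\<in>K. p i * v i\<bar> \<le> 1"
proof -
  have "\<bar>\<Sum>i\<in>K. p i * v i\<bar> \<le> (\<Sum>i\<in>K. \<bar>p i * v i\<bar>)" by (rule sum_abs)
  also have "\<dots> \<le> (\<Sum>i\<in>K. p i)"
    by (rule sum_mono) (use p v in \<open>auto simp: abs_mult intro: mult_left_le\<close>)
  finally show ?thesis using p by simp
qed

text \<open>A moment generating function bound for a variable with values in \<open>[-1, 1]\<close>, from
  \<open>exp x \<le> 1 + x + x\<^sup>2\<close> and the fact that its variance is at most \<open>1\<close>.\<close>

lemma mgf_centered_le:
  fixes p v :: "'i \<Rightarrow> real"
  assumes K: "finite K" and p: "\<And>i. i \<in> K \<Longrightarrow> 0 \<le> p i" "(\<Sum>i\<in>K. p i) = 1"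
    and v: "\<And>i. i \<in> K \<Longrightarrow> \<bar>v i\<bar> \<le> 1" and a: "\<bar>a\<bar> \<le> 1/2"
  shows "(\<Sum>i\<in>K. p i * exp (a * (v i - (\<Sum>i\<in>K. p i * v i)))) \<le> exp (a\<^sup>2)"
proof -
  define F where "F = (\<Sum>i\<in>K. p i * v i)"
  have F: "\<bar>F\<bar> \<le> 1" unfolding F_def by (intro abs_convex_combination_le_one p v)
  have "(\<Sum>i\<in>K. p i * exp (a * (v i - F))) \<le>
      (\<Sum>i\<in>K. p i * (1 + a * (v i - F) + a\<^sup>2 * (1 - 2 * F * v i + F\<^sup>2)))"
  proof (rule sum_mono)
    fix i assume i: "i \<in> K"
    have "\<bar>a\<bar> * \<bar>v i - F\<bar> \<le> 1/2 * 2" using a v[OF i] F by (intro mult_mono) auto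
    then have "exp (a * (v i - F)) \<le> 1 + a * (v i - F) + (a * (v i - F))\<^sup>2"
      by (intro exp_le_quadratic) (simp add: abs_mult)
    also have "(a * (v i - F))\<^sup>2 = a\<^sup>2 * ((v i)\<^sup>2 - 2 * F * v i + F\<^sup>2)"
      by (simp add: power2_eq_square algebra_simps)
    also have "\<dots> \<le> a\<^sup>2 * (1 - 2 * F * v i + F\<^sup>2)"
      using v[OF i] by (intro mult_left_mono) (auto simp: abs_square_le_1)
    finally show "p i * exp (a * (v i - F)) \<le> p i * (1 + a * (v i - F) + a\<^sup>2 * (1 - 2 * F * v i + F\<^sup>2))"
      using p(1)[OF i] by (intro mult_left_mono) auto
  qed
  also have "\<dots> = (\<Sum>i\<in>K. (1 - a * F + a\<^sup>2 * (1 + F\<^sup>2)) * p i + (a - 2 * a\<^sup>2 * F) * (p i * v i))"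
    by (intro sum.cong) (auto simp: algebra_simps)
  also have "\<dots> = (1 - a * F + a\<^sup>2 * (1 + F\<^sup>2)) * (\<Sum>i\<in>K. p i) + (a - 2 * a\<^sup>2 * F) * F"
    by (simp add: sum.distrib sum_distrib_left F_def)
  also have "\<dots> = 1 + a\<^sup>2 - a\<^sup>2 * F\<^sup>2" using p by (simp add: algebra_simps power2_eq_square)
  also have "\<dots> \<le> 1 + a\<^sup>2" by simp
  also have "\<dots> \<le> exp (a\<^sup>2)" by (rule exp_ge_add_one_self)
  finally show ?thesis unfolding F_def .
qed

lemma abs_sum_list_le_length:
  fixes v :: "'i \<Rightarrow> real"
  assumes "\<And>i. i \<in> set xs \<Longrightarrow> \<bar>v i\<bar> \<le> 1"
  shows "\<bar>\<Sum>i\<leftarrow>xs. v i\<bar> \<le> length xs"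
  using assms
proof (induction xs)
  case (Cons y ys)
  have "\<bar>\<Sum>i\<leftarrow>y # ys. v i\<bar> \<le> \<bar>v y\<bar> + \<bar>\<Sum>i\<leftarrow>ys. v i\<bar>"
    using abs_triangle_ineq by simp
  also have "\<dots> \<le> 1 + real (length ys)"
    using Cons.IH Cons.prems by (intro add_mono) simp_all
  finally show ?case by simp
qed simp

text \<open>A derandomized form of the sampling argument of Maurey: for every partial vote, the
  average over the next voter multiplies the functional by at most \<open>exp (a\<^sup>2)\<close>, so some
  voter achieves this factor. Both parts are treated in one functional because the same vote has to work for the
  distribution (upper deviations) and for the sample (lower deviations).\<close>

lemma exists_sparse_average:
  fixes P :: "'z measure" and v :: "'i \<Rightarrow> 'z \<Rightarrow> real" and p :: "'i \<Rightarrow> real" and w :: "'j \<Rightarrow> 'z" and \<beta> a :: real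
  assumes P: "prob_space P" and K: "finite K"
    and p: "\<And>i. i \<in> K \<Longrightarrow> 0 \<le> p i" "(\<Sum>i\<in>K. p i) = 1"
    and v: "\<And>i z. i \<in> K \<Longrightarrow> z \<in> space P \<Longrightarrow> \<bar>v i z\<bar> \<le> 1"
    and vm: "\<And>i. i \<in> K \<Longrightarrow> v i \<in> borel_measurable P"
    and a: "0 \<le> a" "a \<le> 1/2" and \<beta>: "\<beta> \<ge> 0" and w: "\<And>j. j \<in> J \<Longrightarrow> w j \<in> space P"
    and F: "F = (\<lambda>z. \<Sum>i\<in>K. p i * v i z)"
  shows "\<exists>xs. length xs = m \<and> set xs \<subseteq> K \<and>
     (\<integral>z. exp (a * ((\<Sum>i\<leftarrow>xs. v i z) - m * F z)) \<partial>P)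
       + \<beta> * (\<Sum>j\<in>J. exp (- a * ((\<Sum>i\<leftarrow>xs. v i (w j)) - m * F (w j))))
     \<le> (1 + \<beta> * card J) * exp (m * a\<^sup>2)"
proof (induction m)
  case 0
  interpret prob_space P by fact
  show ?case by (intro exI[of _ "[]"]) (simp add: prob_space)
next
  case (Suc m)
  interpret prob_space P by fact
  obtain xs where xs: "length xs = m" "set xs \<subseteq> K" 
    "(\<integral>z. exp (a * ((\<Sum>i\<leftarrow>xs. v i z) - m * F z)) \<partial>P)
       + \<beta> * (\<Sum>j\<in>J. exp (- a * ((\<Sum>i\<leftarrow>xs. v i (w j)) - m * F (w j))))
     \<le> (1 + \<beta> * card J) * exp (m * a\<^sup>2)" using Suc by blast
  define D where "D z = (\<Sum>i\<leftarrow>xs. v i z) - m * F z" for z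
  have Fm: "F \<in> borel_measurable P" unfolding F
    by (intro borel_measurable_sum borel_measurable_times borel_measurable_const vm)
  have sm: "(\<lambda>z. \<Sum>i\<leftarrow>xs. v i z) \<in> borel_measurable P"
    using xs(2) by (induction xs) (auto intro!: borel_measurable_add vm)
  have Dm: "D \<in> borel_measurable P" unfolding D_def
    by (intro borel_measurable_diff borel_measurable_times borel_measurable_const Fm sm)
  have F1: "\<bar>F z\<bar> \<le> 1" if "z \<in> space P" for z
    unfolding F by (intro abs_convex_combination_le_one p v that)
  have D_bd: "\<bar>D z\<bar> \<le> 2 * m" if z: "z \<in> space P" for z
  proof -
    have "\<bar>\<Sum>i\<leftarrow>xs. v i z\<bar> \<le> m"
      using abs_sum_list_le_length[of xs "\<lambda>i. v i z"] xs v[OF _ z] by auto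
    moreover have "\<bar>m * F z\<bar> \<le> m" using F1[OF z] by (auto simp: abs_mult intro: mult_left_le)
    ultimately show ?thesis unfolding D_def by linarith
  qed
  let ?e = "\<lambda>i z. exp (a * (v i z - F z)) * exp (a * D z)"
  let ?e' = "\<lambda>i z. exp (- a * (v i z - F z)) * exp (- a * D z)"
  have int_e: "integrable P (?e i)" if i: "i \<in> K" for i
  proof (rule integrable_const_bound[of _ "exp (a * 2) * exp (a * (2 * m))"])
    show "?e i \<in> borel_measurable P"
      using vm[OF i] Fm Dm by measurable
    show "AE z in P. norm (?e i z) \<le> exp (a * 2) * exp (a * (2 * m))"
    proof (rule AE_I2)
      fix z assume z: "z \<in> space P"
      have "v i z - F z \<le> 2" "D z \<le> 2 * m"
        using v[OF i z] F1[OF z] D_bd[OF z] by linarith+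
      then have "exp (a * (v i z - F z)) \<le> exp (a * 2)" "exp (a * D z) \<le> exp (a * (2 * m))"
        using a by (auto intro!: mult_left_mono)
      then have "?e i z \<le> exp (a * 2) * exp (a * (2 * m))" by (intro mult_mono) auto
      then show "norm (?e i z) \<le> exp (a * 2) * exp (a * (2 * m))" by simp
    qed
  qed
  have int_D: "integrable P (\<lambda>z. exp (a * D z))"
  proof (rule integrable_const_bound[of _ "exp (a * (2 * m))"])
    show "(\<lambda>z. exp (a * D z)) \<in> borel_measurable P" using Dm by measurable
    show "AE z in P. norm (exp (a * D z)) \<le> exp (a * (2 * m))"
    proof (rule AE_I2)
      fix z assume z: "z \<in> space P"
      have "D z \<le> 2 * m" using D_bd[OF z] by linarith
      then show "norm (exp (a * D z)) \<le> exp (a * (2 * m))" using a by (auto intro!: mult_left_mono)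
    qed
  qed
  define \<Phi> where "\<Phi> i = (\<integral>z. ?e i z \<partial>P) + \<beta> * (\<Sum>j\<in>J. ?e' i (w j))" for i
  have "(\<Sum>i\<in>K. p i * \<Phi> i) =
     (\<integral>z. (\<Sum>i\<in>K. p i * ?e i z) \<partial>P) + \<beta> * (\<Sum>j\<in>J. \<Sum>i\<in>K. p i * ?e' i (w j))"
  proof -
    have "(\<integral>z. (\<Sum>i\<in>K. p i * ?e i z) \<partial>P) = (\<Sum>i\<in>K. p i * (\<integral>z. ?e i z \<partial>P))"
      using int_e by (subst Bochner_Integration.integral_sum) auto
    moreover have "(\<Sum>j\<in>J. \<Sum>i\<in>K. p i * ?e' i (w j)) = (\<Sum>i\<in>K. p i * (\<Sum>j\<in>J. ?e' i (w j)))"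
      by (subst sum.swap) (simp add: sum_distrib_left)
    ultimately show ?thesis
      unfolding \<Phi>_def by (simp add: distrib_left sum.distrib sum_distrib_left mult.left_commute)
  qed
  also have "\<dots> \<le> (\<integral>z. exp (a\<^sup>2) * exp (a * D z) \<partial>P) + \<beta> * (\<Sum>j\<in>J. exp (a\<^sup>2) * exp (- a * D (w j)))"
  proof (intro add_mono mult_left_mono sum_mono integral_mono \<beta>)
    show "integrable P (\<lambda>z. \<Sum>i\<in>K. p i * ?e i z)" using int_e by auto
    show "integrable P (\<lambda>z. exp (a\<^sup>2) * exp (a * D z))" using int_D by auto
  next
    fix z assume z: "z \<in> space P"
    have "(\<Sum>i\<in>K. p i * exp (a * (v i z - F z))) \<le> exp (a\<^sup>2)"
      unfolding F using p v z a by (intro mgf_centered_le K) auto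
    then have "(\<Sum>i\<in>K. p i * exp (a * (v i z - F z))) * exp (a * D z) \<le> exp (a\<^sup>2) * exp (a * D z)"
      by (intro mult_right_mono) auto
    then show "(\<Sum>i\<in>K. p i * ?e i z) \<le> exp (a\<^sup>2) * exp (a * D z)"
      by (simp add: sum_distrib_right mult.assoc)
  next
    fix j assume "j \<in> J"
    then have z: "w j \<in> space P" by (rule w)
    have "(\<Sum>i\<in>K. p i * exp (- a * (v i (w j) - F (w j)))) \<le> exp ((- a)\<^sup>2)"
      unfolding F using p v z a by (intro mgf_centered_le K) auto
    then have "(\<Sum>i\<in>K. p i * exp (- a * (v i (w j) - F (w j)))) * exp (- a * D (w j))
        \<le> exp (a\<^sup>2) * exp (- a * D (w j))"
      by (intro mult_right_mono) auto
    then show "(\<Sum>i\<in>K. p i * ?e' i (w j)) \<le> exp (a\<^sup>2) * exp (- a * D (w j))"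
      by (simp add: sum_distrib_right mult.assoc)
  qed
  also have "\<dots> = exp (a\<^sup>2) * ((\<integral>z. exp (a * D z) \<partial>P) + \<beta> * (\<Sum>j\<in>J. exp (- a * D (w j))))"
    by (simp add: distrib_left sum_distrib_left mult.left_commute)
  also have "\<dots> \<le> exp (a\<^sup>2) * ((1 + \<beta> * card J) * exp (m * a\<^sup>2))"
    using xs(3) unfolding D_def by (intro mult_left_mono) auto
  also have "\<dots> = (1 + \<beta> * card J) * exp (Suc m * a\<^sup>2)"
    by (simp add: exp_add distrib_right distrib_left mult_ac)
  finally have avg: "(\<Sum>i\<in>K. p i * \<Phi> i) \<le> (1 + \<beta> * card J) * exp (Suc m * a\<^sup>2)" (is "_ \<le> ?B") .
  have "\<exists>i\<in>K. \<Phi> i \<le> ?B"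
  proof (rule ccontr)
    assume "\<not> ?thesis"
    then have gt: "\<And>i. i \<in> K \<Longrightarrow> ?B < \<Phi> i" by auto
    obtain i0 where i0: "i0 \<in> K" "p i0 \<noteq> 0" using p(2) by (metis sum.neutral zero_neq_one)
    have "(\<Sum>i\<in>K. p i * ?B) < (\<Sum>i\<in>K. p i * \<Phi> i)"
    proof (rule sum_strict_mono_ex1[OF K])
      show "\<forall>i\<in>K. p i * ?B \<le> p i * \<Phi> i" by (intro ballI mult_left_mono less_imp_le gt p(1))
      show "\<exists>i\<in>K. p i * ?B < p i * \<Phi> i"
      proof (rule bexI[OF _ i0(1)])
        have "p i0 > 0" using i0 p(1)[OF i0(1)] by simp
        then show "p i0 * ?B < p i0 * \<Phi> i0" by (rule mult_strict_left_mono[OF gt[OF i0(1)]])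
      qed
    qed
    moreover have "(\<Sum>i\<in>K. p i * ?B) = ?B"
      by (simp only: sum_distrib_right[symmetric] p(2) mult_1_left)
    ultimately show False using avg by linarith
  qed
  then obtain i where i: "i \<in> K" "\<Phi> i \<le> ?B" by blast
  have ee: "exp (c * ((\<Sum>i\<leftarrow>i # xs. v i z) - Suc m * F z)) = exp (c * (v i z - F z)) * exp (c * D z)" for c z
  proof -
    have "c * ((\<Sum>i\<leftarrow>i # xs. v i z) - Suc m * F z) = c * (v i z - F z) + c * D z"
      by (simp add: D_def algebra_simps)
    then show ?thesis by (simp only: exp_add)
  qed
  show ?case
  proof (intro exI[of _ "i # xs"] conjI)
    show "length (i # xs) = Suc m" "set (i # xs) \<subseteq> K" using xs(1,2) i(1) by auto
    show "(\<integral>z. exp (a * ((\<Sum>i\<leftarrow>i # xs. v i z) - Suc m * F z)) \<partial>P)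
       + \<beta> * (\<Sum>j\<in>J. exp (- a * ((\<Sum>i\<leftarrow>i # xs. v i (w j)) - Suc m * F (w j)))) \<le> ?B"
      unfolding ee using i(2) unfolding \<Phi>_def .
  qed
qed

text \<open>Each of the two exceptional events forces a deviation of the vote from \<open>m f\<close> by at least
  \<open>m \<delta> / 2\<close>, so the exponential functional of \<open>exists_sparse_average\<close> bounds both masses. The
  factor \<open>3\<close> on the sample matches the one in the relative deviation inequality, so that the
  empirical frequencies of the vote cancel when the two inequalities are added.\<close>

lemma exists_vote_close_to_sconv:
  fixes P :: "('a \<times> real) measure" and z :: "nat \<Rightarrow> 'a \<times> real"
  assumes P: "prob_space P" "sets P = sets (M \<Otimes>\<^sub>M labels)" and H: "H \<subseteq> measurable M labels"
    and f: "f \<in> sconv H" and \<delta>: "0 < \<delta>" "\<delta> \<le> 1" and n: "n \<ge> 1"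
    and z: "\<And>i. i \<in> {1..n} \<Longrightarrow> z i \<in> space P"
  shows "\<exists>gs. set gs \<subseteq> signed H \<and> length gs = m \<and>
    measure P {z \<in> space P. snd z * f (fst z) \<le> 0}
      + 3 * (real (card {i\<in>{1..n}. z i \<in> margin_set P gs (m * \<delta> / 2)}) / real n)
    \<le> measure P (margin_set P gs (m * \<delta> / 2))
      + 3 * (real (card {i\<in>{1..n}. snd (z i) * f (fst (z i)) \<le> \<delta>}) / real n)
      + 4 * exp (- (m * \<delta>\<^sup>2 / 16))"
proof -
  interpret prob_space P by fact
  obtain N l h where h: "N \<ge> (1::nat)" "\<And>i. i\<in>{1..N} \<Longrightarrow> h i \<in> H" "(\<Sum>i=1..N. \<bar>l i\<bar>) \<le> 1"
    "f = (\<lambda>x. \<Sum>i=1..N. l i * h i x)"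
    using f unfolding sconv_def by blast
  \<comment> \<open>The weights of \<open>f\<close> are completed to a probability by giving the missing mass to the
      zero function, at index \<open>0\<close>.\<close>
  define p where "p i = (if i = 0 then 1 - (\<Sum>i=1..N. \<bar>l i\<bar>) else \<bar>l i\<bar>)" for i
  define g where "g i x = (if i = 0 then 0 * h 1 x else sgn (l i) * h i x)" for i x
  define v where "v i z = snd z * g i (fst z)" for i z
  define F where "F z = snd z * f (fst z)" for z
  have gs: "g i \<in> signed H" if "i \<in> {0..N}" for i
  proof -
    let ?j = "if i = 0 then 1 else i" and ?s = "if i = 0 then 0 else sgn (l i)"
    have "h ?j \<in> H" using that h by auto
    moreover have "?s \<in> {-1, 0, 1}" by (auto simp: sgn_if)
    moreover have "g i = (\<lambda>x. ?s * h ?j x)" by (auto simp: g_def)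
    ultimately show ?thesis unfolding signed_def by blast
  qed
  have split: "(\<Sum>i\<in>{0..N}. q i) = q 0 + (\<Sum>i=1..N. q i)" for q :: "nat \<Rightarrow> real"
    using sum.atLeast_Suc_atMost[of 0 N q] by simp
  have Feq: "F = (\<lambda>z. \<Sum>i\<in>{0..N}. p i * v i z)"
  proof
    fix z
    have "(\<Sum>i\<in>{0..N}. p i * v i z) = (\<Sum>i=1..N. p i * v i z)"
      by (subst split) (simp add: v_def g_def)
    also have "\<dots> = (\<Sum>i=1..N. snd z * (l i * h i (fst z)))"
    proof (rule sum.cong)
      fix i assume i: "i \<in> {1..N}"
      have "\<bar>l i\<bar> * sgn (l i) = l i" by (simp add: sgn_if)
      then show "p i * v i z = snd z * (l i * h i (fst z))"
        using i by (simp add: p_def v_def g_def mult.left_commute flip: mult.assoc)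
    qed simp
    finally show "F z = (\<Sum>i\<in>{0..N}. p i * v i z)"
      by (simp add: F_def h(4) sum_distrib_left)
  qed
  have v1: "\<bar>v i z\<bar> \<le> 1" if i: "i \<in> {0..N}" and z: "z \<in> space P" for i z
  proof -
    obtain s h' where s: "s \<in> {-1, 0, 1}" "h' \<in> H" "g i = (\<lambda>x. s * h' x)"
      using gs[OF i] unfolding signed_def by blast
    have "h' (fst z) \<in> {-1, 1}"
      using measurable_labels_cases[of h' M] s(2) H sample_point_cases[OF P(2) z] by blast
    then show ?thesis using s sample_point_cases(2)[OF P(2) z] by (auto simp: v_def)
  qed
  have p_props: "\<And>i. i \<in> {0..N} \<Longrightarrow> 0 \<le> p i" "(\<Sum>i\<in>{0..N}. p i) = 1"
    using h(3) unfolding split by (auto simp: p_def)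
  have vm: "v i \<in> borel_measurable P" if "i \<in> {0..N}" for i
    unfolding v_def by (intro measurable_margin[OF P(2)] signed_measurable[OF H] gs that)
  \<comment> \<open>Minimizes \<open>a\<^sup>2 - a \<delta> / 2\<close>, the exponent per voter.\<close>
  define a where "a = \<delta> / 4"
  have a: "0 \<le> a" "a \<le> 1/2" using \<delta> by (auto simp: a_def)
  obtain xs where xs: "length xs = m" "set xs \<subseteq> {0..N}"
    "(\<integral>z. exp (a * ((\<Sum>i\<leftarrow>xs. v i z) - m * F z)) \<partial>P)
       + 3 / real n * (\<Sum>j\<in>{1..n}. exp (- a * ((\<Sum>i\<leftarrow>xs. v i (z j)) - m * F (z j))))
     \<le> (1 + 3 / real n * card {1..n}) * exp (m * a\<^sup>2)"
    using exists_sparse_average[where \<beta> = "3 / real n" and J = "{1..n}" and w = z and m = m,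
        OF P(1) finite_atLeastAtMost p_props v1 vm a _ z Feq] by auto
  define gl where "gl = map g xs"
  have gl: "set gl \<subseteq> signed H" "length gl = m" using xs gs by (auto simp: gl_def)
  define D where "D z = (\<Sum>i\<leftarrow>xs. v i z) - m * F z" for z
  have vote: "snd z * (\<Sum>g\<leftarrow>gl. g (fst z)) = (\<Sum>i\<leftarrow>xs. v i z)" for z
    by (simp add: gl_def v_def sum_list_const_mult comp_def)
  let ?A = "margin_set P gl (m * \<delta> / 2)"
  let ?B = "{z \<in> space P. snd z * f (fst z) \<le> 0}"
  have A_iff: "z \<in> ?A \<longleftrightarrow> (\<Sum>i\<leftarrow>xs. v i z) \<le> m * \<delta> / 2" if "z \<in> space P" for z
    using that by (simp add: margin_set_def vote)
  have Fm[measurable]: "F \<in> borel_measurable P"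
    unfolding F_def by (rule measurable_margin[OF P(2) sconv_measurable[OF H f]])
  have Bs[measurable]: "?B \<in> sets P" using Fm unfolding F_def[abs_def] by measurable
  have As[measurable]: "?A \<in> sets P" by (rule margin_set_sets[OF P(2) H gl(1)])
  have Dm[measurable]: "D \<in> borel_measurable P"
  proof -
    have "(\<lambda>z. \<Sum>i\<leftarrow>xs. v i z) \<in> borel_measurable P"
      using xs(2) by (induction xs) (auto intro!: borel_measurable_add vm)
    then show ?thesis unfolding D_def by measurable
  qed
  define c where "c = exp (- (a * (m * \<delta> / 2)))"
  have c0: "c \<ge> 0" by (simp add: c_def)
  have DB: "\<bar>D z\<bar> \<le> 2 * m" if z: "z \<in> space P" for z
  proof -
    have 1: "\<bar>\<Sum>i\<leftarrow>xs. v i z\<bar> \<le> m"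
      using abs_sum_list_le_length[of xs "\<lambda>i. v i z"] xs v1[OF _ z] by fastforce
    have "\<bar>F z\<bar> \<le> 1"
      unfolding Feq by (intro abs_convex_combination_le_one p_props v1 z)
    then have "\<bar>m * F z\<bar> \<le> m" by (auto simp: abs_mult intro: mult_left_le)
    with 1 show ?thesis unfolding D_def by linarith
  qed
  have int: "integrable P (\<lambda>z. c * exp (a * D z))"
  proof (rule integrable_const_bound[of _ "c * exp (a * (2 * m))"])
    show "AE z in P. norm (c * exp (a * D z)) \<le> c * exp (a * (2 * m))"
    proof (rule AE_I2)
      fix z assume z: "z \<in> space P"
      have "D z \<le> 2 * m" using DB[OF z] by linarith
      then have "exp (a * D z) \<le> exp (a * (2 * m))" using a by (auto intro!: mult_left_mono)
      then show "norm (c * exp (a * D z)) \<le> c * exp (a * (2 * m))" using c0 by (auto intro!: mult_left_mono)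
    qed
  qed measurable
  have "measure P ?B \<le> measure P (?A \<union> (?B - ?A))" by (intro finite_measure_mono) auto
  also have "\<dots> \<le> measure P ?A + measure P (?B - ?A)" by (intro measure_Un_le) auto
  also have "measure P (?B - ?A) = (\<integral>z. indicator (?B - ?A) z \<partial>P)" by simp
  also have "\<dots> \<le> (\<integral>z. c * exp (a * D z) \<partial>P)"
  proof (rule integral_mono[OF _ int])
    show "integrable P (indicator (?B - ?A) :: _ \<Rightarrow> real)" by (auto simp: emeasure_eq_measure)
    fix z assume z: "z \<in> space P"
    show "indicator (?B - ?A) z \<le> c * exp (a * D z)"
    proof (cases "z \<in> ?B - ?A")
      case True
      then have "m * F z \<le> 0" by (auto simp: F_def mult_nonneg_nonpos)
      then have "m * \<delta> / 2 \<le> D z" using True A_iff[OF z] unfolding D_def by auto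
      then have "a * (m * \<delta> / 2) \<le> a * D z" using a by (intro mult_left_mono) auto
      then have "1 \<le> exp (- (a * (m * \<delta> / 2)) + a * D z)" by simp
      then have "1 \<le> c * exp (a * D z)" unfolding c_def exp_add .
      then show ?thesis using True by simp
    qed (use c0 in auto)
  qed
  finally have PB: "measure P ?B \<le> measure P ?A + c * (\<integral>z. exp (a * D z) \<partial>P)" by simp
  let ?T = "{i\<in>{1..n}. z i \<in> ?A}" and ?U = "{i\<in>{1..n}. snd (z i) * f (fst (z i)) \<le> \<delta>}"
  have "real (card ?T) \<le> real (card (?U \<union> (?T - ?U)))"
    by (intro of_nat_mono card_mono) auto
  also have "\<dots> \<le> real (card ?U) + real (card (?T - ?U))"
    using card_Un_le[of ?U "?T - ?U"] by linarith
  also have "real (card (?T - ?U)) = (\<Sum>i\<in>?T - ?U. 1)" by simp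
  also have "\<dots> \<le> (\<Sum>i\<in>?T - ?U. c * exp (- a * D (z i)))"
  proof (rule sum_mono)
    fix i assume i: "i \<in> ?T - ?U"
    have "m * \<delta> \<le> m * F (z i)" using i by (intro mult_left_mono) (auto simp: F_def)
    then have "D (z i) \<le> - (m * \<delta> / 2)" using i A_iff[OF z[of i]] unfolding D_def by auto
    then have "a * D (z i) \<le> a * (- (m * \<delta> / 2))" using a by (intro mult_left_mono) auto
    then have "1 \<le> exp (- (a * (m * \<delta> / 2)) + - a * D (z i))" by simp
    then show "1 \<le> c * exp (- a * D (z i))" unfolding c_def exp_add .
  qed
  also have "\<dots> \<le> (\<Sum>i\<in>{1..n}. c * exp (- a * D (z i)))"
    using c0 by (intro sum_mono2) auto
  finally have "3 / real n * real (card ?T) \<le> 3 / real n * (real (card ?U) + c * (\<Sum>i\<in>{1..n}. exp (- a * D (z i))))"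
    by (intro mult_left_mono) (auto simp: sum_distrib_left)
  with PB have "measure P ?B + 3 / real n * real (card ?T) \<le> measure P ?A + 3 / real n * real (card ?U)
      + c * ((\<integral>z. exp (a * D z) \<partial>P) + 3 / real n * (\<Sum>i\<in>{1..n}. exp (- a * D (z i))))"
    by (simp add: algebra_simps)
  also have "c * ((\<integral>z. exp (a * D z) \<partial>P) + 3 / real n * (\<Sum>i\<in>{1..n}. exp (- a * D (z i))))
      \<le> c * ((1 + 3 / real n * card {1..n}) * exp (m * a\<^sup>2))"
    using xs(3) c0 unfolding D_def by (intro mult_left_mono)
  also have "\<dots> = 4 * (c * exp (m * a\<^sup>2))" using n by simp
  also have "c * exp (m * a\<^sup>2) = exp (- (m * \<delta>\<^sup>2 / 16))"
    unfolding c_def a_def exp_add[symmetric] by (simp add: power2_eq_square algebra_simps)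
  finally show ?thesis using gl by (intro exI[of _ gl]) simp
qed

section \<open>Passage from a countable subclass to the full class\<close>

text \<open>Convergent sequences of numbers \<open>-1, 1\<close> are eventually constant. So \<open>f\<close> is not only
  a pointwise limit of functions from the countable class, but agrees with them eventually at each
  point; this makes all margin events converge, without loss in the threshold.\<close>

lemma sconv_pointwise_limit:
  assumes f: "f \<in> sconv H" and pm: "\<And>h x. h \<in> H \<Longrightarrow> x \<in> space M \<Longrightarrow> h x \<in> {-1, 1 :: real}"
    and H0: "H0 \<subseteq> H"
    and app: "\<And>h. h \<in> H \<Longrightarrow> \<exists>g. (\<forall>k::nat. g k \<in> H0) \<and> (\<forall>x\<in>space M. (\<lambda>k. g k x) \<longlonglongrightarrow> h x)"
  shows "\<exists>F. (\<forall>k::nat. F k \<in> sconv H0) \<and>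
    (\<forall>x\<in>space M. eventually (\<lambda>k. F k x = f x) sequentially)"
proof -
  obtain N l h where h: "N \<ge> (1::nat)" "\<And>i. i\<in>{1..N} \<Longrightarrow> h i \<in> H" "(\<Sum>i=1..N. \<bar>l i\<bar>) \<le> 1"
    "f = (\<lambda>x. \<Sum>i=1..N. l i * h i x)"
    using f unfolding sconv_def by blast
  have "\<forall>i\<in>{1..N}. \<exists>g. (\<forall>k::nat. g k \<in> H0) \<and> (\<forall>x\<in>space M. (\<lambda>k. g k x) \<longlonglongrightarrow> h i x)"
    using app h(2) by blast
  from bchoice[OF this] obtain g where
    "\<forall>i\<in>{1..N}. (\<forall>k::nat. g i k \<in> H0) \<and> (\<forall>x\<in>space M. (\<lambda>k. g i k x) \<longlonglongrightarrow> h i x)"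
    by (elim exE)
  then have g: "\<And>i k. i \<in> {1..N} \<Longrightarrow> g i k \<in> H0"
      "\<And>i x. i \<in> {1..N} \<Longrightarrow> x \<in> space M \<Longrightarrow> (\<lambda>k. g i k x) \<longlonglongrightarrow> h i x"
    by simp_all
  define F where "F k x = (\<Sum>i=1..N. l i * g i k x)" for k x
  have "F k \<in> sconv H0" for k
    unfolding sconv_def F_def using h(1,3) g(1)
    by (intro CollectI exI[of _ N] exI[of _ l] exI[of _ "\<lambda>i. g i k"]) auto
  moreover have "eventually (\<lambda>k. F k x = f x) sequentially" if x: "x \<in> space M" for x
  proof -
    have "eventually (\<lambda>k. g i k x = h i x) sequentially" if i: "i \<in> {1..N}" for i
    proof -
      have "eventually (\<lambda>k. dist (g i k x) (h i x) < 1) sequentially"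
        using g(2)[OF i x] by (rule tendstoD) simp
      then show ?thesis
      proof eventually_elim
        case (elim k)
        have "g i k x \<in> {-1, 1}" "h i x \<in> {-1, 1}" using pm[OF _ x] g(1)[OF i] H0 h(2)[OF i] by blast+
        then show ?case using elim by (auto simp: dist_real_def)
      qed
    qed
    then have "eventually (\<lambda>k. \<forall>i\<in>{1..N}. g i k x = h i x) sequentially"
      by (intro eventually_ball_finite) auto
    then show ?thesis by eventually_elim (simp add: F_def h(4))
  qed
  ultimately show ?thesis by (intro exI[of _ F]) simp
qed

lemma measure_limit_of_eventually_equal:
  assumes P: "finite_measure P" and S: "\<And>k::nat. S k \<in> sets P" "T \<in> sets P"
    and ev: "\<And>z. z \<in> space P \<Longrightarrow> eventually (\<lambda>k. z \<in> S k \<longleftrightarrow> z \<in> T) sequentially"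
  shows "(\<lambda>k. measure P (S k)) \<longlonglongrightarrow> measure P T"
proof -
  interpret finite_measure P by fact
  have "(\<lambda>k. \<integral>z. indicator (S k) z \<partial>P) \<longlonglongrightarrow> (\<integral>z. indicator T z \<partial>P :: real)"
  proof (rule integral_dominated_convergence[where w = "\<lambda>_. 1"])
    show "AE z in P. (\<lambda>k. indicator (S k) z :: real) \<longlonglongrightarrow> indicator T z"
    proof (rule AE_I2)
      fix z assume "z \<in> space P"
      then show "(\<lambda>k. indicator (S k) z :: real) \<longlonglongrightarrow> indicator T z"
        by (intro tendsto_eventually) (use ev[of z] in \<open>auto elim!: eventually_mono simp: indicator_def\<close>)
    qed
  qed (use S in \<open>auto simp: indicator_def\<close>)
  then show ?thesis using S by simp
qed

section \<open>A lower bound for the local complexity term\<close>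

lemma L2_dist_refl: "L2_dist Q f f = 0" by (simp add: L2_dist_def)

lemma covering_number_antimono:
  assumes "u \<le> v" shows "covering_number d G v \<le> covering_number d G u"
  unfolding covering_number_def
proof (rule INF_superset_mono)
  have "{g. d c g \<le> u} \<subseteq> {g. d c g \<le> v}" for c using assms by auto
  then have "(\<Union>c\<in>S. {g. d c g \<le> u}) \<subseteq> (\<Union>c\<in>S. {g. d c g \<le> v})" for S
    by (rule UN_mono[OF subset_refl])
  then show "{S. finite S \<and> S \<subseteq> G \<and> G \<subseteq> (\<Union>c\<in>S. {g. d c g \<le> u})}
      \<subseteq> {S. finite S \<and> S \<subseteq> G \<and> G \<subseteq> (\<Union>c\<in>S. {g. d c g \<le> v})}"
    using subset_trans by blast
qed simp

lemma function_covering_number_antimono: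
  assumes "u \<le> v" shows "function_covering_number Q H f v \<le> function_covering_number Q H f u"
  unfolding function_covering_number_def
  by (intro INF_mono) (use covering_number_antimono[OF assms] in blast)

lemma one_le_function_covering_number: "1 \<le> function_covering_number Q H f u"
  unfolding function_covering_number_def covering_number_def
proof (intro INF_greatest)
  fix H' S
  assume H': "H' \<in> {H'. H' \<subseteq> H \<and> f \<in> sconv H'}"
    and S: "S \<in> {S. finite S \<and> S \<subseteq> H' \<and> H' \<subseteq> (\<Union>c\<in>S. {g. L2_dist Q c g \<le> u})}"
  from H' have "H' \<noteq> {}" by (auto simp: sconv_def)
  with S have "S \<noteq> {}" "finite S" by auto
  then have "1 \<le> card S" by (simp add: Suc_le_eq card_gt_0_iff)
  then show "1 \<le> enat (card S)" by (simp add: one_enat_def)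
qed

text \<open>The finitely many functions that represent \<open>f\<close> cover themselves.\<close>

lemma function_covering_number_bounded:
  assumes "f \<in> sconv H"
  obtains k where "\<And>u. u > 0 \<Longrightarrow> function_covering_number Q H f u \<le> enat k"
proof -
  obtain N l h where h: "N \<ge> (1::nat)" "\<forall>i\<in>{1..N}. h i \<in> H" "(\<Sum>i=1..N. \<bar>l i\<bar>) \<le> 1"
    "f = (\<lambda>x. \<Sum>i=1..N. l i * h i x)"
    using assms unfolding sconv_def by blast
  let ?H = "h ` {1..N}"
  have "function_covering_number Q H f u \<le> enat (card ?H)" if "u > 0" for u
  proof -
    have "function_covering_number Q H f u \<le> covering_number (L2_dist Q) ?H u"
      unfolding function_covering_number_def
      by (rule INF_lower) (use h in \<open>auto simp: sconv_def\<close>)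
    also have "\<dots> \<le> enat (card ?H)"
      unfolding covering_number_def
      by (rule INF_lower) (use that in \<open>force simp: L2_dist_refl\<close>)
    finally show ?thesis .
  qed
  then show ?thesis by (rule that)
qed

text \<open>Covering numbers are monotone in the radius, hence measurable, and the integrand is at
  most a multiple of \<open>\<epsilon> powr (-1/2)\<close>, because \<open>ln (1/\<epsilon>) \<le> 1/\<epsilon>\<close>.\<close>

lemma psi_integrand_set_integrable:
  assumes "f \<in> sconv H"
  shows "set_integrable lborel {0<..c}
    (\<lambda>\<epsilon>. sqrt (real (the_enat (function_covering_number Q H f \<epsilon>)) * max 0 (ln (1 / \<epsilon>))))"
proof -
  let ?N = "\<lambda>\<epsilon>. real (the_enat (function_covering_number Q H f \<epsilon>))"
  obtain k where k: "\<And>u. u > 0 \<Longrightarrow> function_covering_number Q H f u \<le> enat k"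
    using function_covering_number_bounded[OF assms] by blast
  have Nk: "?N u \<le> real k" if "u > 0" for u
    using k[OF that] by (cases "function_covering_number Q H f u") auto
  have N_mono: "?N v \<le> ?N u" if "0 < u" "u \<le> v" for u v
  proof -
    have "0 < v" using that by linarith
    then show ?thesis
    using function_covering_number_antimono[OF that(2), of Q H f] k[OF that(1)] k[of v]
    by (cases "function_covering_number Q H f u"; cases "function_covering_number Q H f v") auto
  qed
  \<comment> \<open>For \<open>u < 0\<close> the covering number is infinite and its numerical value meaningless;
    replacing it by the bound \<open>k\<close> gives a function that is monotone on the whole line.\<close>
  define N' where "N' u = (if u \<le> 0 then real k else ?N u)" for u
  have "mono (\<lambda>u. - N' u)"
    using Nk N_mono by (intro monoI) (auto simp: N'_def)
  then have "(\<lambda>u. - N' u) \<in> borel_measurable borel" by (rule borel_measurable_mono)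
  then have "(\<lambda>u. - (- N' u)) \<in> borel_measurable borel" by (rule borel_measurable_uminus)
  then have N'm[measurable]: "N' \<in> borel_measurable borel" by simp
  let ?g' = "\<lambda>\<epsilon>. sqrt (N' \<epsilon> * max 0 (ln (1 / \<epsilon>)))"
  have pow: "set_integrable lborel {0<..c} (\<lambda>x. sqrt k * x powr (-1/2))"
  proof (cases "c \<ge> 0")
    case True
    have "(\<lambda>x::real. x powr (-1/2)) integrable_on {0<..c}"
      using integrable_on_powr_from_0'[of "-1/2" c] True by simp
    then have "(\<lambda>x::real. x powr (-1/2)) absolutely_integrable_on {0<..c}"
      by (rule nonnegative_absolutely_integrable_1) auto
    then have "set_integrable lborel {0<..c} (\<lambda>x::real. x powr (-1/2))"
      unfolding set_integrable_def by (subst (asm) integrable_completion) auto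
    then show ?thesis by (rule set_integrable_mult_right)
  next
    case False
    then have "{0<..c} = {}" by auto
    then show ?thesis by (simp add: set_integrable_def)
  qed
  have "set_integrable lborel {0<..c} ?g'"
  proof (rule set_integrable_bound[OF pow])
    show "set_borel_measurable lborel {0<..c} ?g'"
      unfolding set_borel_measurable_def by measurable
    show "AE x in lborel. x \<in> {0<..c} \<longrightarrow> norm (?g' x) \<le> norm (sqrt k * x powr (-1/2))"
    proof (intro AE_I2 impI)
      fix x assume x: "x \<in> {0<..c}"
      have "N' x * max 0 (ln (1/x)) \<le> k * (1/x)"
      proof (rule mult_mono)
        show "N' x \<le> k" using Nk[of x] x by (simp add: N'_def)
        show "max 0 (ln (1/x)) \<le> 1/x" using ln_le_minus_one[of "1/x"] x by auto
      qed auto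
      then have "?g' x \<le> sqrt (k * (1/x))" by (rule real_sqrt_le_mono)
      also have "\<dots> = sqrt k * x powr (-1/2)"
        using x by (simp add: real_sqrt_mult real_sqrt_divide powr_minus_divide powr_half_sqrt)
      finally have "?g' x \<le> sqrt k * x powr (-1/2)" .
      moreover have "0 \<le> ?g' x" by (simp add: N'_def)
      ultimately show "norm (?g' x) \<le> norm (sqrt k * x powr (-1/2))" by simp
    qed
  qed
  moreover have "indicator {0<..c} x *\<^sub>R ?g' x =
      indicator {0<..c} x *\<^sub>R sqrt (?N x * max 0 (ln (1 / x)))" for x
  proof (cases "x \<in> {0<..c}")
    case True
    then have "N' x = ?N x" by (simp add: N'_def)
    then show ?thesis by (simp only:)
  next
    case False
    then have "indicator {0<..c} x = (0::real)" by (rule indicator_simps(2))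
    then show ?thesis by (simp only: scaleR_zero_left)
  qed
  ultimately show ?thesis unfolding set_integrable_def by (simp only:)
qed

lemma psi_hat_continuous_on:
  assumes "f \<in> sconv H"
  shows "continuous_on {0..b} (psi_hat Q H f)"
proof -
  let ?g = "\<lambda>\<epsilon>. sqrt (real (the_enat (function_covering_number Q H f \<epsilon>)) * max 0 (ln (1 / \<epsilon>)))"
  have eq: "psi_hat Q H f x = integral {0..x} ?g" for x
  proof -
    have "psi_hat Q H f x = integral {0<..x} ?g"
      unfolding psi_hat_def
      by (rule set_borel_integral_eq_integral(2)[OF psi_integrand_set_integrable[OF assms]])
    also have "\<dots> = integral {0..x} ?g"
      by (rule integral_subset_negligible) (auto intro: negligible_subset[of "{0}"])
    finally show ?thesis .
  qed
  have "?g integrable_on {0<..b}"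
    by (rule set_borel_integral_eq_integral(1)[OF psi_integrand_set_integrable[OF assms]])
  then have "?g integrable_on {0..b}"
    by (rule integrable_spike_set) (auto intro: negligible_subset[of "{0}"])
  then have "continuous_on {0..b} (\<lambda>x. integral {0..x} ?g)"
    by (rule indefinite_integral_continuous_1)
  then show ?thesis unfolding eq[abs_def] .
qed

lemma psi_hat_le_at_1:
  assumes "f \<in> sconv H"
  shows "psi_hat Q H f x \<le> psi_hat Q H f 1"
proof -
  let ?g = "\<lambda>\<epsilon>. sqrt (real (the_enat (function_covering_number Q H f \<epsilon>)) * max 0 (ln (1 / \<epsilon>)))"
  note i = psi_integrand_set_integrable[OF assms, of _ Q]
  show ?thesis unfolding psi_hat_def set_lebesgue_integral_def
  proof (rule integral_mono)
    show "integrable lborel (\<lambda>\<epsilon>. indicator {0<..x} \<epsilon> *\<^sub>R ?g \<epsilon>)"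
      "integrable lborel (\<lambda>\<epsilon>. indicator {0<..1} \<epsilon> *\<^sub>R ?g \<epsilon>)"
      using i unfolding set_integrable_def by auto
    fix \<epsilon> :: real
    have "?g \<epsilon> = 0" if "\<epsilon> > 1" using that by (simp add: max_def)
    moreover have "?g \<epsilon> \<ge> 0" by simp
    ultimately show "indicator {0<..x} \<epsilon> *\<^sub>R ?g \<epsilon> \<le> indicator {0<..1} \<epsilon> *\<^sub>R ?g \<epsilon>"
      by (auto simp: indicator_def not_le)
  qed
qed

text \<open>Covering numbers are at least \<open>1\<close> and the logarithm is decreasing in \<open>\<epsilon>\<close>.\<close>

lemma psi_hat_lower_bound:
  assumes "f \<in> sconv H" "0 < x" "x \<le> 1"
  shows "x * sqrt (ln (1 / x)) \<le> psi_hat Q H f x"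
proof -
  let ?g = "\<lambda>\<epsilon>. sqrt (real (the_enat (function_covering_number Q H f \<epsilon>)) * max 0 (ln (1 / \<epsilon>)))"
  obtain k where k: "\<And>u. u > 0 \<Longrightarrow> function_covering_number Q H f u \<le> enat k"
    using function_covering_number_bounded[OF assms(1)] by blast
  have "(LBINT \<epsilon>:{0<..x}. sqrt (ln (1/x))) \<le> psi_hat Q H f x"
    unfolding psi_hat_def
  proof (rule set_integral_mono)
    show "set_integrable lborel {0<..x} ?g" by (rule psi_integrand_set_integrable[OF assms(1)])
    show "set_integrable lborel {0<..x} (\<lambda>_. sqrt (ln (1/x)))"
      using assms by (simp add: set_integrable_def)
    fix \<epsilon> assume e: "\<epsilon> \<in> {0<..x}"
    have "1 \<le> real (the_enat (function_covering_number Q H f \<epsilon>))"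
      using one_le_function_covering_number[of Q H f \<epsilon>] k[of \<epsilon>] e
      by (cases "function_covering_number Q H f \<epsilon>") (auto simp: one_enat_def)
    moreover have "ln (1/x) \<le> ln (1/\<epsilon>)" "0 \<le> ln (1/x)"
      using e assms by (auto simp: ln_div)
    ultimately have "1 * ln (1/x) \<le> real (the_enat (function_covering_number Q H f \<epsilon>)) * max 0 (ln (1 / \<epsilon>))"
      by (intro mult_mono) auto
    then show "sqrt (ln (1/x)) \<le> ?g \<epsilon>" by simp
  qed
  moreover have "(LBINT \<epsilon>:{0<..x}. sqrt (ln (1/x))) = x * sqrt (ln (1/x))"
    using assms by (simp add: set_lebesgue_integral_def)
  ultimately show ?thesis by simp
qed

text \<open>The solutions form a compact set, because \<open>\<psi>\<close> is continuous and bounded above; so a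
  largest one exists. The intermediate value theorem places a solution above every \<open>e\<close> at which
  the right side of the equation is still at least \<open>e\<close>.\<close>

lemma eps_sol_ge:
  fixes \<psi> :: "real \<Rightarrow> real"
  assumes cont: "\<And>b. continuous_on {0..b} \<psi>" and bd: "\<And>x. \<psi> x \<le> B"
    and \<delta>: "\<delta> > 0" and n: "n \<ge> 1" and e: "e \<ge> 0"
    and lower: "e \<le> 1 / (\<delta> * sqrt (real n)) * \<psi> (\<delta> * sqrt e)"
  shows "e \<le> eps_sol n \<psi> \<delta>"
proof -
  define c where "c = 1 / (\<delta> * sqrt (real n))"
  have c: "c > 0" using \<delta> n by (simp add: c_def)
  define F where "F x = c * \<psi> (\<delta> * sqrt x) - x" for x
  have contF: "continuous_on {0..b} F" for b
  proof -
    have "continuous_on {0..b} (\<psi> \<circ> (\<lambda>x. \<delta> * sqrt x))"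
    proof (rule continuous_on_compose)
      show "continuous_on {0..b} (\<lambda>x. \<delta> * sqrt x)" by (intro continuous_intros)
      show "continuous_on ((\<lambda>x. \<delta> * sqrt x) ` {0..b}) \<psi>"
        by (rule continuous_on_subset[OF cont[of "\<delta> * sqrt b"]]) (use \<delta> in auto)
    qed
    then show ?thesis unfolding F_def comp_def by (intro continuous_intros)
  qed
  have up: "F x \<le> c * B - x" for x
    unfolding F_def using bd[of "\<delta> * sqrt x"] c by simp
  let ?b = "max e (c * B)"
  have "\<exists>x\<ge>e. x \<le> ?b \<and> F x = 0"
  proof (rule IVT2')
    show "F ?b \<le> 0" using up[of ?b] by linarith
    show "0 \<le> F e" using lower by (simp add: F_def c_def)
    show "continuous_on {e..?b} F" using contF[of ?b] by (rule continuous_on_subset) (use e in auto)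
  qed auto
  then obtain x0 where x0: "e \<le> x0" "x0 \<le> ?b" "F x0 = 0" by blast
  let ?S = "{x\<in>{0..?b}. F x = 0}"
  have "closed ?S"
    using continuous_closed_preimage_constant[OF contF[of ?b]] by simp
  moreover have "bounded ?S" by (rule bounded_subset[of "{0..?b}"]) auto
  ultimately have "compact ?S" by (simp add: compact_eq_bounded_closed)
  moreover have "?S \<noteq> {}" using x0 e by auto
  ultimately obtain s where s: "s \<in> ?S" "\<forall>t\<in>?S. t \<le> s" using compact_attains_sup by blast
  have "eps_sol n \<psi> \<delta> = s"
    unfolding eps_sol_def c_def[symmetric]
  proof (rule Greatest_equality)
    show "0 \<le> s \<and> s = c * \<psi> (\<delta> * sqrt s)" using s(1) by (simp add: F_def)
    fix y assume y: "0 \<le> y \<and> y = c * \<psi> (\<delta> * sqrt y)"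
    then have "F y = 0" by (simp add: F_def)
    moreover from this have "y \<le> c * B" using up[of y] by linarith
    ultimately show "y \<le> s" using s(2) y by auto
  qed
  moreover have "x0 \<le> s" using s(2) x0 e by auto
  ultimately show ?thesis using x0 by simp
qed

text \<open>At \<open>\<epsilon> = 1/(4n)\<close> the argument \<open>x = \<delta> \<surd>\<epsilon>\<close> is at most \<open>1/2\<close>, so that \<open>ln (1/x)\<close> is at least
  \<open>1/4\<close>; this is enough for the right side of the equation to be at least \<open>\<epsilon>\<close>.\<close>

lemma eps_hat_ge:
  assumes f: "f \<in> sconv H" and \<delta>: "0 < \<delta>" "\<delta> \<le> 1" and n: "n \<ge> 1"
  shows "1 / (4 * real n) \<le> eps_hat n z H f \<delta>"
  unfolding eps_hat_def
proof (rule eps_sol_ge[OF psi_hat_continuous_on[OF f] psi_hat_le_at_1[OF f] \<delta>(1) n])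
  let ?Q = "measure_pmf (map_pmf fst (empirical n z))"
  let ?e = "1 / (4 * real n)" let ?r = "sqrt (real n)"
  have r: "?r \<ge> 1" using n by simp
  have se: "sqrt ?e = 1 / (2 * ?r)"
    by (simp add: real_sqrt_divide real_sqrt_mult)
  let ?x = "\<delta> * sqrt ?e"
  have x: "0 < ?x" "?x \<le> 1/2"
  proof -
    show "0 < ?x" using \<delta> n by simp
    have "sqrt ?e \<le> 1/2" unfolding se using r by (simp add: divide_le_eq)
    moreover have "0 \<le> sqrt ?e" by (intro real_sqrt_ge_zero) simp
    ultimately have "?x \<le> 1 * (1/2)" using \<delta> by (intro mult_mono) linarith+
    then show "?x \<le> 1/2" by simp
  qed
  have "1/4 \<le> ln (2::real)" using ln2_ge_two_thirds by simp
  also have "\<dots> \<le> ln (1/?x)" using x by (subst ln_le_cancel_iff) (auto simp: field_simps)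
  finally have "sqrt (1/4) \<le> sqrt (ln (1/?x))" by (rule real_sqrt_le_mono)
  then have half: "1/2 \<le> sqrt (ln (1/?x))" by (simp add: real_sqrt_divide)
  have "?e = 1 / (\<delta> * ?r) * (?x * (1/2))"
    using \<delta> n unfolding se by (simp add: field_simps)
  also have "\<dots> \<le> 1 / (\<delta> * ?r) * (?x * sqrt (ln (1/?x)))"
    using half x \<delta> by (intro mult_left_mono) auto
  also have "\<dots> \<le> 1 / (\<delta> * ?r) * psi_hat ?Q H f ?x"
    using psi_hat_lower_bound[OF f x(1), of ?Q] x \<delta> by (intro mult_left_mono) auto
  finally show "?e \<le> 1 / (\<delta> * ?r) * psi_hat ?Q H f ?x" .
qed simp

section \<open>The margin bound\<close>

lemma ln_growth_le:
  fixes A V u0 x :: real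
  assumes pos: "A > 0" "V > 0" "u0 > 0" and x: "x > 1" "ln x \<ge> 1/2"
  shows "ln (A * min u0 (1 / sqrt x) powr (-V)) \<le> (2 * \<bar>ln A\<bar> + 2 * V * \<bar>ln u0\<bar> + V) * ln x"
proof -
  let ?u = "min u0 (1 / sqrt x)"
  have sx: "sqrt x > 0" using x by simp
  have u: "?u > 0" using pos sx by simp
  have "ln (1 / sqrt x) = - (ln x / 2)" using x by (simp add: ln_div ln_sqrt)
  then have "- ln ?u \<le> \<bar>ln u0\<bar> + ln x / 2" using x by (auto simp: min_def)
  then have "V * (- ln ?u) \<le> V * (\<bar>ln u0\<bar> + ln x / 2)" using pos by (intro mult_left_mono) auto
  moreover have "ln (A * ?u powr (-V)) = ln A + V * (- ln ?u)"
  proof -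
    have "ln (A * u powr (-V)) = ln A + V * (- ln u)" if "u > 0" for u :: real
      using pos that by (simp add: ln_mult_pos ln_powr)
    then show ?thesis using u by blast
  qed
  ultimately have "ln (A * ?u powr (-V)) \<le> \<bar>ln A\<bar> * 1 + V * \<bar>ln u0\<bar> * 1 + V * (ln x / 2)"
    by (simp add: distrib_left)
  also have "\<dots> \<le> \<bar>ln A\<bar> * (2 * ln x) + V * \<bar>ln u0\<bar> * (2 * ln x) + V * (ln x)"
    using pos x by (intro add_mono mult_left_mono) auto
  finally show ?thesis by (simp add: algebra_simps)
qed

text \<open>The number of voters is chosen so that the sampling error is \<open>1/n\<close>. Terms of order
  \<open>1\<close> are absorbed into multiples of \<open>ln n\<close>, which is at least \<open>1/2\<close>.\<close>

lemma vote_complexity_le: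
  fixes A V u0 \<delta> t :: real and n m :: nat
  assumes pos: "A > 0" "V > 0" "u0 > 0" and n: "n \<ge> 2" and \<delta>: "0 < \<delta>" "\<delta> \<le> 1"
    and G: "G = A * min u0 (1 / sqrt n) powr (-V)"
    and m: "m = nat \<lceil>16 * ln n / \<delta>\<^sup>2\<rceil>"
    and t: "t \<ge> 18 * (10 + (2 * \<bar>ln A\<bar> + 2 * V * \<bar>ln u0\<bar> + V)) * (ln n)\<^sup>2"
  shows "ln ((real m + 1) * (3 * G) ^ m) + (real m + 1) * ln 2 \<le> t / \<delta>\<^sup>2"
    and "exp (- (m * \<delta>\<^sup>2 / 16)) \<le> 1 / n" and "t \<ge> 1"
proof -
  define L where "L = ln (real n)"
  define C1 where "C1 = 2 * \<bar>ln A\<bar> + 2 * V * \<bar>ln u0\<bar> + V"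
  have C1: "C1 \<ge> 0" using pos by (simp add: C1_def)
  have "ln 2 \<le> L" unfolding L_def using n by (subst ln_le_cancel_iff) auto
  then have L: "L \<ge> 1/2" using ln2_ge_two_thirds by linarith
  have d2: "0 < \<delta>\<^sup>2" "\<delta>\<^sup>2 \<le> 1" using \<delta> by (auto simp: power_le_one)
  have m_ge: "real m \<ge> 16 * L / \<delta>\<^sup>2" unfolding m L_def by linarith
  have "0 < 16 * L / \<delta>\<^sup>2" using L d2 by simp
  with m_ge have "real m > 0" by linarith
  then have m1: "real m \<ge> 1" by simp
  have "real m \<le> 16 * L / \<delta>\<^sup>2 + 1" using \<open>0 < 16 * L / \<delta>\<^sup>2\<close> unfolding m L_def by linarith
  also have "1 \<le> 2 * L / \<delta>\<^sup>2" using L d2 by (simp add: le_divide_eq)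
  finally have m_le: "real m \<le> 18 * L / \<delta>\<^sup>2" by simp
  have "L \<le> m * \<delta>\<^sup>2 / 16" using m_ge d2 by (simp add: field_simps)
  then have "exp (- (m * \<delta>\<^sup>2 / 16)) \<le> exp (- L)" by simp
  also have "\<dots> = 1 / n" using n by (simp add: L_def exp_minus inverse_eq_divide)
  finally show "exp (- (m * \<delta>\<^sup>2 / 16)) \<le> 1 / n" .
  have "(1/2)\<^sup>2 \<le> L\<^sup>2" using L by (intro power_mono) auto
  then have "18 * 10 * (1/4) \<le> 18 * (10 + C1) * L\<^sup>2"
    using C1 by (intro mult_mono) (auto simp: power_divide)
  then show "t \<ge> 1" using t unfolding C1_def L_def by linarith
  have "min u0 (1 / sqrt n) > 0" using pos n by simp
  then have G0: "G > 0" using pos unfolding G by (metis mult_pos_pos powr_gt_zero less_numeral_extra(3))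
  have lnG: "ln G \<le> C1 * L" unfolding G C1_def L_def
    using n L by (intro ln_growth_le pos) (auto simp: L_def)
  have "ln ((real m + 1) * (3 * G) ^ m) = ln (real m + 1) + m * (ln 3 + ln G)"
    using G0 by (simp add: ln_mult_pos ln_realpow distrib_left)
  moreover have "ln (real m + 1) \<le> m" using ln_le_minus_one[of "real m + 1"] by simp
  moreover have "ln (3::real) \<le> 2" using ln_le_minus_one[of 3] by simp
  then have "m * (ln 3 + ln G) \<le> m * (2 + C1 * L)" using lnG by (intro mult_left_mono) auto
  moreover have "(real m + 1) * ln 2 \<le> (real m + 1) * 1" using ln_2_less_1 by (intro mult_left_mono) auto
  ultimately have "ln ((real m + 1) * (3 * G) ^ m) + (real m + 1) * ln 2 \<le> m + m * (2 + C1 * L) + (real m + 1) * 1"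
    by (metis add_mono)
  also have "\<dots> \<le> real m * (5 + C1 * L)" using m1 by (simp add: algebra_simps)
  also have "\<dots> \<le> m * ((10 + C1) * L)" using L by (intro mult_left_mono) (auto simp: algebra_simps)
  also have "\<dots> \<le> (18 * L / \<delta>\<^sup>2) * ((10 + C1) * L)"
    using m_le C1 L by (intro mult_right_mono) auto
  also have "\<dots> = (18 * (10 + C1) * L\<^sup>2) / \<delta>\<^sup>2" by (simp add: power2_eq_square)
  also have "\<dots> \<le> t / \<delta>\<^sup>2" using t d2 unfolding C1_def L_def by (intro divide_right_mono) auto
  finally show "ln ((real m + 1) * (3 * G) ^ m) + (real m + 1) * ln 2 \<le> t / \<delta>\<^sup>2" .
qed

lemma prob_empirical:
  assumes "n \<ge> 1"
  shows "measure_pmf.prob (empirical n z) S = real (card {i\<in>{1..n}. z i \<in> S}) / real n"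
proof -
  have "{1..n} \<inter> z -` S = {i\<in>{1..n}. z i \<in> S}" by auto
  then show ?thesis using assms by (simp add: empirical_def measure_pmf_of_set)
qed

text \<open>The good event is defined through the countable subclass. On it the inequality is derived
  for convex combinations from that subclass and extended to \<open>sconv H\<close> by a limit in which the
  right side is eventually constant.\<close>

lemma margin_bound_high_probability:
  fixes M :: "'a measure" and P :: "('a \<times> real) measure" and \<Omega> :: "'w measure"
  assumes P: "prob_space P" "sets P = sets (M \<Otimes>\<^sub>M labels)"
    and H: "H \<subseteq> measurable M labels" "pointwise_measurable M H" "uniform_covering_bound M H V A u0"
    and \<Omega>: "prob_space \<Omega>" and n: "n \<ge> 2"
    and indep: "prob_space.indep_vars \<Omega> (\<lambda>_. P) Z {1..n}"
    and distr: "\<And>i. i \<in> {1..n} \<Longrightarrow> distr \<Omega> P (Z i) = P"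
    and pos: "A > 0" "V > 0" "u0 > 0"
    and t: "t \<ge> 18 * (10 + (2 * \<bar>ln A\<bar> + 2 * V * \<bar>ln u0\<bar> + V)) * (ln n)\<^sup>2"
  shows "\<exists>E\<in>sets \<Omega>. measure \<Omega> E \<ge> 1 - exp (-t) \<and> (\<forall>\<omega>\<in>E. \<forall>f\<in>sconv H. \<forall>\<delta>\<in>{0<..1::real}.
     measure P {z\<in>space P. snd z * f (fst z) \<le> 0}
       \<le> 3 * measure_pmf.prob (empirical n (\<lambda>i. Z i \<omega>)) {z. snd z * f (fst z) \<le> \<delta>} + 10 * (t / (real n * \<delta>\<^sup>2)))"
proof -
  interpret P: prob_space P by fact
  interpret O: prob_space \<Omega> by fact
  have n1: "n \<ge> 1" using n by simp
  have pm: "h x \<in> {-1, 1}" if "h \<in> H" "x \<in> space M" for h x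
    using measurable_labels_cases[of h M x] that H(1) by blast
  obtain H0 where H0: "H0 \<subseteq> H" "countable H0"
    and app: "\<And>h. h \<in> H \<Longrightarrow> \<exists>g. (\<forall>k::nat. g k \<in> H0) \<and> (\<forall>x\<in>space M. (\<lambda>k. g k x) \<longlonglongrightarrow> h x)"
    using H(2) unfolding pointwise_measurable_def by blast
  have H0m: "H0 \<subseteq> measurable M labels" using H0 H by blast
  define G where "G = A * min u0 (1 / sqrt n) powr (-V)"
  have "min u0 (1 / sqrt n) > 0" using pos n by simp
  then have G0: "G > 0" using pos unfolding G_def by (metis mult_pos_pos powr_gt_zero less_numeral_extra(3))
  define N where "N m = (real m + 1) * (3 * G) ^ m" for m
  have N0: "N m > 0" for m using G0 unfolding N_def by (intro mult_pos_pos zero_less_power) auto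
  have sub: "vote_sets P H0 m \<subseteq> sets P" for m
    unfolding vote_sets_def using margin_set_sets[OF P(2) H0m] by auto
  have card: "real (card (hits {1..2*n} w ` vote_sets P H0 m)) \<le> N m"
    if w: "w \<in> {1..2*n} \<rightarrow> space P" for m w
  proof -
    let ?p = "\<lambda>h. \<lambda>j\<in>{1..2*n}. h (fst (w j))"
    have x: "(\<lambda>j. fst (w j)) \<in> {1..2*n} \<rightarrow> space M" using w sample_point_cases(1)[OF P(2)] by blast
    have "finite (?p ` H) \<and> real (card (?p ` H)) \<le> G"
      unfolding G_def by (rule finite_patterns_card_le[OF H(3) pos(3) n1 x]) (rule pm)
    then have fin: "finite (?p ` H)" "real (card (?p ` H)) \<le> G" by auto
    have s: "?p ` H0 \<subseteq> ?p ` H" using H0 by blast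
    then have "real (card (?p ` H0)) \<le> G" using card_mono[OF fin(1) s] fin(2) by linarith
    then show ?thesis unfolding N_def
      by (rule card_hits_vote_sets_le[OF w finite_subset[OF s fin(1)]])
  qed
  have "\<exists>E\<in>sets \<Omega>. measure \<Omega> E \<ge> 1 - exp (-t) \<and> (\<forall>\<omega>\<in>E. \<forall>m. \<forall>S\<in>vote_sets P H0 m. measure P S \<le>
        3 * (real (card {i\<in>{1..n}. Z i \<omega> \<in> S}) / real n) + 3 * (ln (N m) + (real m + 1) * ln 2 + t) / real n)"
    by (rule relative_deviation_uniform[OF P(1) \<Omega> n1 indep])
      (use distr countable_vote_sets[OF H0(2)] sub N0 card in blast)+
  then obtain E where E: "E \<in> sets \<Omega>" "measure \<Omega> E \<ge> 1 - exp (-t)" and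
    dev': "\<forall>\<omega>\<in>E. \<forall>m. \<forall>S\<in>vote_sets P H0 m. measure P S \<le>
        3 * (real (card {i\<in>{1..n}. Z i \<omega> \<in> S}) / real n) + 3 * (ln (N m) + (real m + 1) * ln 2 + t) / real n"
    by (elim bexE conjE)
  note dev = dev'[rule_format]
  have main: "measure P {z\<in>space P. snd z * f (fst z) \<le> 0}
       \<le> 3 * (real (card {i\<in>{1..n}. snd (Z i \<omega>) * f (fst (Z i \<omega>)) \<le> \<delta>}) / real n) + 10 * (t / (real n * \<delta>\<^sup>2))"
    if w: "\<omega> \<in> E" and Zs: "\<And>i. i \<in> {1..n} \<Longrightarrow> Z i \<omega> \<in> space P" and f: "f \<in> sconv H0" and \<delta>: "0 < \<delta>" "\<delta> \<le> 1" for \<omega> f and \<delta> :: real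
  proof -
    define m where "m = nat \<lceil>16 * ln n / \<delta>\<^sup>2\<rceil>"
    note c = vote_complexity_le[OF pos n \<delta> G_def m_def t]
    obtain gs where gs: "set gs \<subseteq> signed H0" "length gs = m" and
      ineq: "measure P {z \<in> space P. snd z * f (fst z) \<le> 0}
        + 3 * (real (card {i\<in>{1..n}. Z i \<omega> \<in> margin_set P gs (m * \<delta> / 2)}) / real n)
      \<le> measure P (margin_set P gs (m * \<delta> / 2))
        + 3 * (real (card {i\<in>{1..n}. snd (Z i \<omega>) * f (fst (Z i \<omega>)) \<le> \<delta>}) / real n)
        + 4 * exp (- (m * \<delta>\<^sup>2 / 16))"
      using exists_vote_close_to_sconv[OF P H0m f \<delta> n1, of "\<lambda>i. Z i \<omega>" m] Zs by blast
    have "real m * \<delta> \<le> real m * 1" using \<delta> by (intro mult_left_mono) auto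
    then have "margin_set P gs (m * \<delta> / 2) \<in> vote_sets P H0 m"
      using \<delta> by (intro margin_set_in_vote_sets[OF P(2) H0m gs]) auto
    note step = dev[OF w this] ineq c(2)
    have complexity: "3 * (ln (N m) + (real m + 1) * ln 2 + t) / real n + 4 * (1 / real n)
        \<le> 10 * (t / (real n * \<delta>\<^sup>2))"
    proof -
      have "t * \<delta>\<^sup>2 \<le> t * 1" using c(3) \<delta> by (intro mult_left_mono) (auto simp: power_le_one)
      then have "t \<le> t / \<delta>\<^sup>2" using \<delta> by (simp add: le_divide_eq)
      with c(1,3) have "3 * (ln (N m) + (real m + 1) * ln 2 + t) + 4 \<le> 10 * (t / \<delta>\<^sup>2)"
        unfolding N_def by argo
      then have "(3 * (ln (N m) + (real m + 1) * ln 2 + t) + 4) / real n \<le> 10 * (t / \<delta>\<^sup>2) / real n"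
        by (rule divide_right_mono) simp
      then show ?thesis by (simp add: add_divide_distrib mult.commute)
    qed
    show ?thesis using step complexity by argo
  qed
  show ?thesis
  proof (intro bexI[OF _ E(1)] conjI E(2) ballI)
    fix \<omega> f \<delta> assume w: "\<omega> \<in> E" and f: "f \<in> sconv H" and "\<delta> \<in> {0<..1::real}"
    then have \<delta>: "0 < \<delta>" "\<delta> \<le> 1" by auto
    have Zs: "Z i \<omega> \<in> space P" if "i \<in> {1..n}" for i
    proof -
      have "Z i \<in> measurable \<Omega> P" using indep that unfolding O.indep_vars_def by blast
      moreover have "\<omega> \<in> space \<Omega>" using w sets.sets_into_space[OF E(1)] by blast
      ultimately show ?thesis by (rule measurable_space)
    qed
    have "\<exists>F. (\<forall>k::nat. F k \<in> sconv H0) \<and>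
        (\<forall>x\<in>space M. eventually (\<lambda>k. F k x = f x) sequentially)"
      by (rule sconv_pointwise_limit[OF f _ H0(1)]) (erule (1) pm, erule app)
    then obtain F where F: "\<And>k::nat. F k \<in> sconv H0"
      "\<And>x. x \<in> space M \<Longrightarrow> eventually (\<lambda>k. F k x = f x) sequentially"
      by blast
    let ?B = "\<lambda>f. {z\<in>space P. snd z * f (fst z) \<le> 0}"
    let ?c = "\<lambda>f. real (card {i\<in>{1..n}. snd (Z i \<omega>) * f (fst (Z i \<omega>)) \<le> \<delta>})"
    have Bs: "?B f \<in> sets P" if "f \<in> sconv H" for f
    proof -
      have [measurable]: "(\<lambda>z. snd z * f (fst z)) \<in> borel_measurable P"
        by (rule measurable_margin[OF P(2) sconv_measurable[OF H(1) that]])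
      show ?thesis by measurable
    qed
    have "sconv H0 \<subseteq> sconv H" using H0(1) unfolding sconv_def by blast
    then have FH: "F k \<in> sconv H" for k using F(1) by blast
    have lim: "(\<lambda>k. measure P (?B (F k))) \<longlonglongrightarrow> measure P (?B f)"
    proof (rule measure_limit_of_eventually_equal)
      fix z assume z: "z \<in> space P"
      show "eventually (\<lambda>k. z \<in> ?B (F k) \<longleftrightarrow> z \<in> ?B f) sequentially"
        using F(2)[OF sample_point_cases(1)[OF P(2) z]] by eventually_elim simp
    qed (use P.finite_measure_axioms Bs FH f in auto)
    have "eventually (\<lambda>k. \<forall>i\<in>{1..n}. F k (fst (Z i \<omega>)) = f (fst (Z i \<omega>))) sequentially"
      using F(2) sample_point_cases(1)[OF P(2) Zs] by (intro eventually_ball_finite) auto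
    then have "eventually (\<lambda>k. measure P (?B (F k)) \<le> 3 * (?c f / real n) + 10 * (t / (real n * \<delta>\<^sup>2))) sequentially"
    proof eventually_elim
      case (elim k)
      then have "?c (F k) = ?c f" by (intro arg_cong[where f = "\<lambda>S. real (card S)"]) auto
      then show ?case using main[OF w Zs F(1)[of k] \<delta>] by simp
    qed
    then have "measure P (?B f) \<le> 3 * (?c f / real n) + 10 * (t / (real n * \<delta>\<^sup>2))"
      by (rule tendsto_upperbound[OF lim]) simp
    then show "measure P (?B f) \<le> 3 * measure_pmf.prob (empirical n (\<lambda>i. Z i \<omega>)) {z. snd z * f (fst z) \<le> \<delta>}
        + 10 * (t / (real n * \<delta>\<^sup>2))"
      by (simp add: prob_empirical[OF n1])
  qed
qed

theorem theorem5:
  "\<exists>K>0. \<forall>V>0. \<forall>A>0. \<forall>u0>0. \<exists>C>0.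
     \<forall>(M :: 'a measure) (P :: ('a \<times> real) measure) (H :: ('a \<Rightarrow> real) set)
      (\<Omega> :: 'w measure) (Z :: nat \<Rightarrow> 'w \<Rightarrow> 'a \<times> real) (n :: nat) (t :: real).
       prob_space P \<longrightarrow> sets P = sets (M \<Otimes>\<^sub>M labels) \<longrightarrow>
       H \<subseteq> measurable M labels \<longrightarrow> pointwise_measurable M H \<longrightarrow>
       uniform_covering_bound M H V A u0 \<longrightarrow>
       prob_space \<Omega> \<longrightarrow> n \<ge> 1 \<longrightarrow>
       prob_space.indep_vars \<Omega> (\<lambda>_. P) Z {1..n} \<longrightarrow>
       (\<forall>i\<in>{1..n}. distr \<Omega> P (Z i) = P) \<longrightarrow>
       t \<ge> C * (ln (real n))\<^sup>2 \<longrightarrow>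
       (\<exists>E\<in>sets \<Omega>. measure \<Omega> E \<ge> 1 - exp (- t) \<and>
          (\<forall>\<omega>\<in>E. \<forall>f\<in>sconv H.
             measure P {z \<in> space P. snd z * f (fst z) \<le> 0} \<le>
             K * (INF \<delta>\<in>{0<..1}.
                    measure_pmf.prob (empirical n (\<lambda>i. Z i \<omega>)) {z. snd z * f (fst z) \<le> \<delta>}
                    + eps_hat n (\<lambda>i. Z i \<omega>) H f \<delta> + t / (real n * \<delta>\<^sup>2))))"
proof (rule exI[of _ "10::real"], intro conjI allI impI)
  fix V A u0 :: real assume pos: "V > 0" "A > 0" "u0 > 0"
  define C where "C = 18 * (10 + (2 * \<bar>ln A\<bar> + 2 * V * \<bar>ln u0\<bar> + V))"
  have C: "C > 0" using pos unfolding C_def by (intro mult_pos_pos add_pos_nonneg) auto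
  show "\<exists>C>0. \<forall>(M :: 'a measure) (P :: ('a \<times> real) measure) (H :: ('a \<Rightarrow> real) set)
      (\<Omega> :: 'w measure) (Z :: nat \<Rightarrow> 'w \<Rightarrow> 'a \<times> real) (n :: nat) (t :: real).
       prob_space P \<longrightarrow> sets P = sets (M \<Otimes>\<^sub>M labels) \<longrightarrow>
       H \<subseteq> measurable M labels \<longrightarrow> pointwise_measurable M H \<longrightarrow>
       uniform_covering_bound M H V A u0 \<longrightarrow>
       prob_space \<Omega> \<longrightarrow> n \<ge> 1 \<longrightarrow>
       prob_space.indep_vars \<Omega> (\<lambda>_. P) Z {1..n} \<longrightarrow>
       (\<forall>i\<in>{1..n}. distr \<Omega> P (Z i) = P) \<longrightarrow>
       t \<ge> C * (ln (real n))\<^sup>2 \<longrightarrow>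
       (\<exists>E\<in>sets \<Omega>. measure \<Omega> E \<ge> 1 - exp (- t) \<and>
          (\<forall>\<omega>\<in>E. \<forall>f\<in>sconv H.
             measure P {z \<in> space P. snd z * f (fst z) \<le> 0} \<le>
             10 * (INF \<delta>\<in>{0<..1}.
                    measure_pmf.prob (empirical n (\<lambda>i. Z i \<omega>)) {z. snd z * f (fst z) \<le> \<delta>}
                    + eps_hat n (\<lambda>i. Z i \<omega>) H f \<delta> + t / (real n * \<delta>\<^sup>2))))"
  proof (rule exI[of _ C], intro conjI allI impI C)
    fix M :: "'a measure" and P :: "('a \<times> real) measure" and H :: "('a \<Rightarrow> real) set"
      and \<Omega> :: "'w measure" and Z :: "nat \<Rightarrow> 'w \<Rightarrow> 'a \<times> real" and n :: nat and t :: real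
    assume P: "prob_space P" "sets P = sets (M \<Otimes>\<^sub>M labels)"
      and H: "H \<subseteq> measurable M labels" "pointwise_measurable M H" "uniform_covering_bound M H V A u0"
      and \<Omega>: "prob_space \<Omega>" and n: "n \<ge> 1"
      and indep: "prob_space.indep_vars \<Omega> (\<lambda>_. P) Z {1..n}"
      and distr: "\<forall>i\<in>{1..n}. distr \<Omega> P (Z i) = P"
      and t: "t \<ge> C * (ln (real n))\<^sup>2"
    interpret P: prob_space P by fact
    interpret O: prob_space \<Omega> by fact
    have t0: "t \<ge> 0" using t C by (meson order_trans mult_nonneg_nonneg less_imp_le zero_le_power2)
    let ?R = "\<lambda>\<omega> f \<delta>. measure_pmf.prob (empirical n (\<lambda>i. Z i \<omega>)) {z. snd z * f (fst z) \<le> \<delta>}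
                    + eps_hat n (\<lambda>i. Z i \<omega>) H f \<delta> + t / (real n * \<delta>\<^sup>2)"
    have "\<exists>E\<in>sets \<Omega>. measure \<Omega> E \<ge> 1 - exp (- t) \<and>
       (\<forall>\<omega>\<in>E. \<forall>f\<in>sconv H. \<forall>\<delta>\<in>{0<..1}. measure P {z \<in> space P. snd z * f (fst z) \<le> 0} \<le> 10 * ?R \<omega> f \<delta>)"
    proof (cases "n = 1")
      case True
      have "measure P {z \<in> space P. snd z * f (fst z) \<le> 0} \<le> 10 * ?R \<omega> f \<delta>"
        if f: "f \<in> sconv H" and \<delta>: "\<delta> \<in> {0<..1}" for \<omega> f \<delta>
      proof -
        have "1 / 4 \<le> eps_hat n (\<lambda>i. Z i \<omega>) H f \<delta>"
          using eps_hat_ge[OF f _ _ n, of \<delta> "\<lambda>i. Z i \<omega>"] \<delta> True by auto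
        moreover have "0 \<le> t / (real n * \<delta>\<^sup>2)" using t0 by simp
        moreover have "0 \<le> measure_pmf.prob (empirical n (\<lambda>i. Z i \<omega>)) {z. snd z * f (fst z) \<le> \<delta>}" by simp
        moreover have "p \<le> 10 * (a + e + q)" if "1/4 \<le> e" "0 \<le> q" "0 \<le> a" "p \<le> 1" for p a e q :: real
          using that by argo
        ultimately show ?thesis using P.prob_le_1[of "{z \<in> space P. snd z * f (fst z) \<le> 0}"] by blast
      qed
      then show ?thesis using O.prob_space by (intro bexI[of _ "space \<Omega>"]) auto
    next
      case False
      then have n2: "n \<ge> 2" using n by simp
      have "\<exists>E\<in>sets \<Omega>. measure \<Omega> E \<ge> 1 - exp (-t) \<and> (\<forall>\<omega>\<in>E. \<forall>f\<in>sconv H. \<forall>\<delta>\<in>{0<..1}.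
          measure P {z\<in>space P. snd z * f (fst z) \<le> 0}
          \<le> 3 * measure_pmf.prob (empirical n (\<lambda>i. Z i \<omega>)) {z. snd z * f (fst z) \<le> \<delta>} + 10 * (t / (real n * \<delta>\<^sup>2)))"
        by (rule margin_bound_high_probability[OF P H \<Omega> n2 indep _ pos(2,1,3) t[unfolded C_def]])
          (rule distr[rule_format])
      then obtain E where E: "E \<in> sets \<Omega>" "measure \<Omega> E \<ge> 1 - exp (-t)" and
        b': "\<forall>\<omega>\<in>E. \<forall>f\<in>sconv H. \<forall>\<delta>\<in>{0<..1}. measure P {z\<in>space P. snd z * f (fst z) \<le> 0}
          \<le> 3 * measure_pmf.prob (empirical n (\<lambda>i. Z i \<omega>)) {z. snd z * f (fst z) \<le> \<delta>} + 10 * (t / (real n * \<delta>\<^sup>2))"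
        by (elim bexE conjE)
      note b = b'[rule_format]
      have "measure P {z \<in> space P. snd z * f (fst z) \<le> 0} \<le> 10 * ?R \<omega> f \<delta>"
        if w: "\<omega> \<in> E" and f: "f \<in> sconv H" and \<delta>: "\<delta> \<in> {0<..1}" for \<omega> f \<delta>
      proof -
        have "1 / (4 * real n) \<le> eps_hat n (\<lambda>i. Z i \<omega>) H f \<delta>"
          using \<delta> by (intro eps_hat_ge[OF f _ _ n]) auto
        then have "0 \<le> eps_hat n (\<lambda>i. Z i \<omega>) H f \<delta>" by (rule order_trans[rotated]) simp
        moreover have "0 \<le> measure_pmf.prob (empirical n (\<lambda>i. Z i \<omega>)) {z. snd z * f (fst z) \<le> \<delta>}" by simp
        moreover have "p \<le> 10 * (a + e + q)" if "0 \<le> e" "0 \<le> a" "p \<le> 3 * a + 10 * q" for p a e q :: real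
          using that by argo
        ultimately show ?thesis using b[OF w f \<delta>] by blast
      qed
      then show ?thesis using E by blast
    qed
    then obtain E where E: "E \<in> sets \<Omega>" "measure \<Omega> E \<ge> 1 - exp (- t)"
      and b: "\<And>\<omega> f \<delta>. \<omega> \<in> E \<Longrightarrow> f \<in> sconv H \<Longrightarrow> \<delta> \<in> {0<..1} \<Longrightarrow>
        measure P {z \<in> space P. snd z * f (fst z) \<le> 0} \<le> 10 * ?R \<omega> f \<delta>" by blast
    have "measure P {z \<in> space P. snd z * f (fst z) \<le> 0} \<le> 10 * (INF \<delta>\<in>{0<..1}. ?R \<omega> f \<delta>)"
      if w: "\<omega> \<in> E" and f: "f \<in> sconv H" for \<omega> f
    proof -
      have "measure P {z \<in> space P. snd z * f (fst z) \<le> 0} / 10 \<le> (INF \<delta>\<in>{0<..1}. ?R \<omega> f \<delta>)"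
      proof (rule cINF_greatest)
        fix \<delta> :: real assume "\<delta> \<in> {0<..1}"
        have scale: "p / 10 \<le> r" if "p \<le> 10 * r" for p r :: real using that by simp
        show "measure P {z \<in> space P. snd z * f (fst z) \<le> 0} / 10 \<le> ?R \<omega> f \<delta>"
          by (rule scale[OF b[OF w f \<open>\<delta> \<in> {0<..1}\<close>]])
      qed simp
      then show ?thesis by linarith
    qed
    then show "\<exists>E\<in>sets \<Omega>. measure \<Omega> E \<ge> 1 - exp (- t) \<and>
          (\<forall>\<omega>\<in>E. \<forall>f\<in>sconv H.
             measure P {z \<in> space P. snd z * f (fst z) \<le> 0} \<le> 10 * (INF \<delta>\<in>{0<..1}. ?R \<omega> f \<delta>))"
      using E by blast
  qed
qed simp

end
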